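(* Let $n\ge 2$ and $\boldsymbol\mu\in\mathcal M^n$ with $\mu_1>\mu_2\ge\dots\ge\mu_n$, and fix $\alpha\in(1,e/2]$. Run Tri-BBAI with $\epsilon=\frac{1}{\log\log(1/\delta)}$, $L_1=\sqrt{\log(1/\delta)}$, $L_2=\frac{\log(1/\delta)\log\log(1/\delta)}{n}$, $L_3=(\log(1/\delta))^2$, and $\beta(t,\delta)=\log\!\big(\log(1/\delta)\,t^{\alpha}/\delta\big)$, and let $B_\delta$ be the number of batches it uses. Then $\limsup_{\delta\to0}\mathbb E_{\boldsymbol\mu}[B_\delta]\le 3$ (i.e. $\mathbb E[B_\delta]\le 3+o(1)$ as $\delta\to0$), and there exists $\delta_0\in(0,1)$ such that for all $\delta\in(0,\delta_0)$, $\mathbb P_{\boldsymbol\mu}(B_\delta\le 3)\ge 1-\frac{1}{(\log(1/\delta))^2}$.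
   Context: Bandit model. Fix a one-parameter canonical exponential family $\{\nu_\theta\}_{\theta\in\Theta}$ ($\Theta$ an open interval): $\frac{d\nu_\theta}{d\rho}(x)=\exp(x\theta-b(\theta))$ for a reference measure $\rho$ on $\mathbb R$, with $b(\theta)=\log\int e^{x\theta}d\rho(x)$. The mean map $\theta\mapsto b'(\theta)$ is a bijection from $\Theta$ onto an open interval $\mathcal M$, so members of the family are indexed by their mean. For $\mu,\mu'\in\mathcal M$, $d(\mu,\mu')$ denotes the Kullback–Leibler divergence from the member with mean $\mu$ to the member with mean $\mu'$. An instance is $\boldsymbol\mu\in\mathcal M^n$; pulling arm $i$ yields a fresh independent sample from the member with mean $\mu_i$. All logarithms are natural. Characteristic time. For $\boldsymbol\lambda\in\mathcal M^n$ and an index $k$ with $\lambda_k>\lambda_j$ for all $j\ne k$, let $\mathrm{Alt}_k(\boldsymbol\lambda)=\{\boldsymbol\lambda'\in\mathcal M^n:\lambda'_j>\lambda'_k\text{ for some }j\neq k\}$, $\mathcal P_n$ the probability simplex in $\mathbb R^n$, and $T^*(\boldsymbol\lambda)^{-1}=\sup_{\mathbf w\in\mathcal P_n}\inf_{\boldsymbol\lambda'\in\mathrm{Alt}_k(\boldsymbol\lambda)}\sum_{i=1}^n w_i\,d(\lambda_i,\lambda'_i)$, with $\mathbf w^*(\boldsymbol\lambda)\in\mathcal P_n$ the (unique) maximizer. Notation during a run. After $t$ total pulls, $N_i(t)$ is the number of pulls of arm $i$, $\hat\mu_i(t)$ the empirical mean of its samples, $i^*(t)\in\arg\max_i\hat\mu_i(t)$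 (ties broken by smallest index). For arms $i,j$: $\hat\mu_{ij}(t)=\frac{N_i(t)\hat\mu_i(t)+N_j(t)\hat\mu_j(t)}{N_i(t)+N_j(t)}$; if $\hat\mu_i(t)\ge\hat\mu_j(t)$, $Z_{ij}(t)=N_i(t)\,d(\hat\mu_i(t),\hat\mu_{ij}(t))+N_j(t)\,d(\hat\mu_j(t),\hat\mu_{ij}(t))$, and $Z_j(t)=Z_{i^*(t)j}(t)$. Tri-BBAI algorithm (parameters $\delta,\epsilon,L_1,L_2,L_3,\alpha,\beta$). Stage I (one batch): pull every arm $\lceil L_1\rceil$ times; set $T_i^0=L_1$ for all $i$ and $\mathbf w^*(\mathbf b^0)=(1/n,\dots,1/n)$. Stage II: for $q=1,2,\dots,\lceil\log(1/\delta)\rceil$, with $t$ the current total number of pulls, set $b^q_i=\hat\mu_i(t)+\epsilon$ for $i\ne i^*(t)$ and $b^q_{i^*(t)}=\hat\mu_{i^*(t)}(t)-\epsilon$; compute $\mathbf w^*(\mathbf b^q)$ and $T^*(\mathbf b^q)$ with designated index $k=i^*(t)$ (convention: if $\mathbf b^q\notin\mathcal M^n$ or $i^*(t)$ is not the unique maximal coordinate of $\mathbf b^q$, set $\mathbf w^*(\mathbf b^q)$ uniform and $T^*(\mathbf b^q)=+\infty$); let $T_i^q=\min\{\alpha\,w_i^*(\mathbf b^q)T^*(\mathbf b^q)\log(1/\delta),\,L_2\}$; in one batch pull each arm $i$ exactly $\max\{0,\lceil T_i^q\rceil-\lceil\max_{0\le p<q}T_i^p\rceil\}$ times; then if $|w_i^*(\mathbf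 b^q)-w_i^*(\mathbf b^{q-1})|\le 1/\sqrt n$ for all $i\in[n]$, leave Stage II. Stage III: let $\tau$ be the current total number of pulls; if $\min_{j\ne i^*(\tau)}Z_j(\tau)\ge\beta(\tau,\delta/2)$, stop and output $i^*(\tau)$. Stage IV (one batch, only if Stage III did not stop): pull each arm $i$ an additional $\max\{0,\lceil L_3\rceil-N_i(\tau)\}$ times and output the arm with largest empirical mean. The batch complexity is the number of batches used (Stage I, each executed iteration of Stage II, and Stage IV if executed). *)

theory Defs
  imports "HOL-Probability.Probability" "HOL-Library.Liminf_Limsup"
begin

definition ef_b :: "real measure \<Rightarrow> real \<Rightarrow> real" where
  "ef_b \<rho> \<theta> = ln (\<integral>x. exp (x * \<theta>) \<partial>\<rho>)"

definition ef_nu :: "real measure \<Rightarrow> real \<Rightarrow> real measure" where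
  "ef_nu \<rho> \<theta> = density \<rho> (\<lambda>x. ennreal (exp (x * \<theta> - ef_b \<rho> \<theta>)))"

text \<open>Natural parameter of the member with mean mu (inverse of the mean map b').\<close>
definition ef_param :: "real measure \<Rightarrow> real set \<Rightarrow> real \<Rightarrow> real" where
  "ef_param \<rho> \<Theta> \<mu> = (THE \<theta>. \<theta> \<in> \<Theta> \<and> deriv (ef_b \<rho>) \<theta> = \<mu>)"

definition ef_member :: "real measure \<Rightarrow> real set \<Rightarrow> real \<Rightarrow> real measure" where
  "ef_member \<rho> \<Theta> \<mu> = ef_nu \<rho> (ef_param \<rho> \<Theta> \<mu>)"

text \<open>d(mu,mu') = KL(nu_mu || nu_mu'), natural log.  Note that the library's
  KL_divergence b M N is the divergence of N from M, i.e. the integral of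
  log (dN/dM) w.r.t. N.\<close>
definition ef_kl :: "real measure \<Rightarrow> real set \<Rightarrow> real \<Rightarrow> real \<Rightarrow> real" where
  "ef_kl \<rho> \<Theta> \<mu> \<mu>' =
     KL_divergence (exp 1) (ef_member \<rho> \<Theta> \<mu>') (ef_member \<rho> \<Theta> \<mu>)"

definition canonical_expfam :: "real measure \<Rightarrow> real set \<Rightarrow> real set \<Rightarrow> bool" where
  "canonical_expfam \<rho> \<Theta> M \<longleftrightarrow>
     sets \<rho> = sets borel \<and>
     open \<Theta> \<and> is_interval \<Theta> \<and> \<Theta> \<noteq> {} \<and>
     (\<forall>\<theta>\<in>\<Theta>. integrable \<rho> (\<lambda>x. exp (x * \<theta>))) \<and>
     open M \<and> is_interval M \<and>
     bij_betw (deriv (ef_b \<rho>)) \<Theta> M"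

section \<open>Characteristic time (arms are indexed 0..n-1)\<close>

definition prob_simplex :: "nat \<Rightarrow> (nat \<Rightarrow> real) set" where
  "prob_simplex n = {w. (\<forall>i<n. 0 \<le> w i) \<and> (\<Sum>i<n. w i) = 1 \<and> (\<forall>i\<ge>n. w i = 0)}"

definition Alt :: "real set \<Rightarrow> nat \<Rightarrow> nat \<Rightarrow> (nat \<Rightarrow> real) \<Rightarrow> (nat \<Rightarrow> real) set" where
  "Alt M n k lam = {lam'. (\<forall>i<n. lam' i \<in> M) \<and> (\<exists>j<n. j \<noteq> k \<and> lam' j > lam' k)}"

definition alt_value ::
  "(real \<Rightarrow> real \<Rightarrow> real) \<Rightarrow> real set \<Rightarrow> nat \<Rightarrow> nat \<Rightarrow> (nat \<Rightarrow> real) \<Rightarrow> (nat \<Rightarrow> real) \<Rightarrow> real" where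
  "alt_value d M n k lam w = (INF lam'\<in>Alt M n k lam. \<Sum>i<n. w i * d (lam i) (lam' i))"

definition Tstar_inv ::
  "(real \<Rightarrow> real \<Rightarrow> real) \<Rightarrow> real set \<Rightarrow> nat \<Rightarrow> nat \<Rightarrow> (nat \<Rightarrow> real) \<Rightarrow> real" where
  "Tstar_inv d M n k lam = (SUP w\<in>prob_simplex n. alt_value d M n k lam w)"

definition valid_instance :: "real set \<Rightarrow> nat \<Rightarrow> nat \<Rightarrow> (nat \<Rightarrow> real) \<Rightarrow> bool" where
  "valid_instance M n k lam \<longleftrightarrow> k < n \<and> (\<forall>i<n. lam i \<in> M) \<and> (\<forall>j<n. j \<noteq> k \<longrightarrow> lam j < lam k)"

definition uniform_w :: "nat \<Rightarrow> nat \<Rightarrow> real" where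
  "uniform_w n = (\<lambda>i. if i < n then 1 / real n else 0)"

text \<open>w*(lambda), with the algorithm's convention for invalid inputs.\<close>
definition wstar ::
  "(real \<Rightarrow> real \<Rightarrow> real) \<Rightarrow> real set \<Rightarrow> nat \<Rightarrow> nat \<Rightarrow> (nat \<Rightarrow> real) \<Rightarrow> nat \<Rightarrow> real" where
  "wstar d M n k lam =
     (if valid_instance M n k lam
      then (SOME w. w \<in> prob_simplex n \<and> alt_value d M n k lam w = Tstar_inv d M n k lam)
      else uniform_w n)"

definition Tstar ::
  "(real \<Rightarrow> real \<Rightarrow> real) \<Rightarrow> real set \<Rightarrow> nat \<Rightarrow> nat \<Rightarrow> (nat \<Rightarrow> real) \<Rightarrow> ereal" where
  "Tstar d M n k lam =
     (if valid_instance M n k lam then ereal (1 / Tstar_inv d M n k lam) else \<infinity>)"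

text \<open>Sample model: X (i, j) is the j-th sample (j = 0,1,...) of arm i; after N i pulls
  of arm i the algorithm has seen X (i, 0), ..., X (i, N i - 1).\<close>

definition emp_mean :: "(nat \<times> nat \<Rightarrow> real) \<Rightarrow> (nat \<Rightarrow> nat) \<Rightarrow> nat \<Rightarrow> real" where
  "emp_mean X N i = (\<Sum>j<N i. X (i, j)) / real (N i)"

definition emp_best :: "nat \<Rightarrow> (nat \<Rightarrow> real) \<Rightarrow> nat" where
  "emp_best n m = (LEAST i. i < n \<and> (\<forall>j<n. m j \<le> m i))"

definition Zstat :: "(real \<Rightarrow> real \<Rightarrow> real) \<Rightarrow> nat \<Rightarrow> nat \<Rightarrow> real \<Rightarrow> real \<Rightarrow> real" where
  "Zstat d Ni Nj mi mj =
     (let m = (real Ni * mi + real Nj * mj) / (real Ni + real Nj)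
      in real Ni * d mi m + real Nj * d mj m)"

text \<open>State after Stage I and q (unconditionally executed) Stage II iterations:
  (pull counts, max over p of T^p_i so far, w*(b^q)).\<close>
fun stage2 ::
  "(real \<Rightarrow> real \<Rightarrow> real) \<Rightarrow> real set \<Rightarrow> nat \<Rightarrow> real \<Rightarrow> real \<Rightarrow> real \<Rightarrow> real \<Rightarrow> real
   \<Rightarrow> (nat \<times> nat \<Rightarrow> real) \<Rightarrow> nat
   \<Rightarrow> (nat \<Rightarrow> nat) \<times> (nat \<Rightarrow> real) \<times> (nat \<Rightarrow> real)" where
  "stage2 d M n \<delta> \<epsilon> L1 L2 \<alpha> X 0 =
     ((\<lambda>i. if i < n then nat \<lceil>L1\<rceil> else 0), (\<lambda>i. L1), uniform_w n)"
| "stage2 d M n \<delta> \<epsilon> L1 L2 \<alpha> X (Suc q) =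
     (let (N, Tm, _) = stage2 d M n \<delta> \<epsilon> L1 L2 \<alpha> X q;
          k = emp_best n (emp_mean X N);
          b = (\<lambda>i. if i = k then emp_mean X N i - \<epsilon> else emp_mean X N i + \<epsilon>);
          w = wstar d M n k b;
          T = (\<lambda>i. real_of_ereal (min (ereal \<alpha> * ereal (w i) * Tstar d M n k b * ereal (ln (1 / \<delta>)))
                                        (ereal L2)));
          N' = (\<lambda>i. if i < n then N i + nat (\<lceil>T i\<rceil> - \<lceil>Tm i\<rceil>) else 0);
          Tm' = (\<lambda>i. max (Tm i) (T i))
      in (N', Tm', w))"

definition stage2_exit ::
  "(real \<Rightarrow> real \<Rightarrow> real) \<Rightarrow> real set \<Rightarrow> nat \<Rightarrow> real \<Rightarrow> real \<Rightarrow> real \<Rightarrow> real \<Rightarrow> real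
   \<Rightarrow> (nat \<times> nat \<Rightarrow> real) \<Rightarrow> nat \<Rightarrow> bool" where
  "stage2_exit d M n \<delta> \<epsilon> L1 L2 \<alpha> X q \<longleftrightarrow>
     (\<forall>i<n. \<bar>snd (snd (stage2 d M n \<delta> \<epsilon> L1 L2 \<alpha> X q)) i
              - snd (snd (stage2 d M n \<delta> \<epsilon> L1 L2 \<alpha> X (q - 1))) i\<bar> \<le> 1 / sqrt (real n))"

definition stage2_iters ::
  "(real \<Rightarrow> real \<Rightarrow> real) \<Rightarrow> real set \<Rightarrow> nat \<Rightarrow> real \<Rightarrow> real \<Rightarrow> real \<Rightarrow> real \<Rightarrow> real
   \<Rightarrow> (nat \<times> nat \<Rightarrow> real) \<Rightarrow> nat" where
  "stage2_iters d M n \<delta> \<epsilon> L1 L2 \<alpha> X =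
     (let qmax = nat \<lceil>ln (1 / \<delta>)\<rceil> in
      if \<exists>q. 1 \<le> q \<and> q \<le> qmax \<and> stage2_exit d M n \<delta> \<epsilon> L1 L2 \<alpha> X q
      then (LEAST q. 1 \<le> q \<and> q \<le> qmax \<and> stage2_exit d M n \<delta> \<epsilon> L1 L2 \<alpha> X q)
      else qmax)"

definition stage3_stops ::
  "(real \<Rightarrow> real \<Rightarrow> real) \<Rightarrow> real set \<Rightarrow> nat \<Rightarrow> real \<Rightarrow> real \<Rightarrow> real \<Rightarrow> real \<Rightarrow> real
   \<Rightarrow> (real \<Rightarrow> real \<Rightarrow> real) \<Rightarrow> (nat \<times> nat \<Rightarrow> real) \<Rightarrow> bool" where
  "stage3_stops d M n \<delta> \<epsilon> L1 L2 \<alpha> \<beta> X \<longleftrightarrow>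
     (let N = fst (stage2 d M n \<delta> \<epsilon> L1 L2 \<alpha> X (stage2_iters d M n \<delta> \<epsilon> L1 L2 \<alpha> X));
          \<tau> = (\<Sum>i<n. N i);
          m = emp_mean X N;
          k = emp_best n m
      in \<forall>j<n. j \<noteq> k \<longrightarrow> Zstat d (N k) (N j) (m k) (m j) \<ge> \<beta> (real \<tau>) (\<delta> / 2))"

text \<open>Batch complexity: Stage I, each executed Stage II iteration, and Stage IV if
  executed.  (The number of Stage IV pulls, governed by L3, does not affect it.)\<close>
definition tri_bbai_batches ::
  "(real \<Rightarrow> real \<Rightarrow> real) \<Rightarrow> real set \<Rightarrow> nat \<Rightarrow> real \<Rightarrow> real \<Rightarrow> real \<Rightarrow> real \<Rightarrow> real
   \<Rightarrow> (real \<Rightarrow> real \<Rightarrow> real) \<Rightarrow> (nat \<times> nat \<Rightarrow> real) \<Rightarrow> nat" where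
  "tri_bbai_batches d M n \<delta> \<epsilon> L1 L2 \<alpha> \<beta> X =
     1 + stage2_iters d M n \<delta> \<epsilon> L1 L2 \<alpha> X
       + (if stage3_stops d M n \<delta> \<epsilon> L1 L2 \<alpha> \<beta> X then 0 else 1)"

definition sample_space :: "real measure \<Rightarrow> real set \<Rightarrow> nat \<Rightarrow> (nat \<Rightarrow> real) \<Rightarrow> (nat \<times> nat \<Rightarrow> real) measure" where
  "sample_space \<rho> \<Theta> n \<mu> = (\<Pi>\<^sub>M p\<in>{..<n} \<times> UNIV. ef_member \<rho> \<Theta> (\<mu> (fst p)))"

definition B_delta :: "real measure \<Rightarrow> real set \<Rightarrow> real set \<Rightarrow> nat \<Rightarrow> real \<Rightarrow> real
   \<Rightarrow> (nat \<times> nat \<Rightarrow> real) \<Rightarrow> nat" where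
  "B_delta \<rho> \<Theta> M n \<alpha> \<delta> =
     tri_bbai_batches (ef_kl \<rho> \<Theta>) M n \<delta>
       (1 / ln (ln (1 / \<delta>)))
       (sqrt (ln (1 / \<delta>)))
       (ln (1 / \<delta>) * ln (ln (1 / \<delta>)) / real n)
       \<alpha>
       (\<lambda>t \<delta>'. ln (ln (1 / \<delta>') * t powr \<alpha> / \<delta>'))"

end

theory Submission
  imports Defs "HOL-Real_Asymp.Real_Asymp"
begin

text \<open>
  Only the law of large numbers and continuity are needed, since the gap between \<open>\<alpha> > 1\<close> and \<open>1\<close>
  absorbs all errors. In mean coordinates the divergence is a Bregman divergence, so the inner
  infimum of the characteristic time is a minimum of pairwise costs \<open>I\<^sub>j(w\<^sub>k, w\<^sub>j)\<close> that are
  homogeneous and superadditive. At an optimum all \<open>I\<^sub>j\<close> coincide, which together with the equality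
  case of superadditivity makes \<open>w*\<close> unique; compactness of the simplex then makes \<open>w*\<close> and \<open>T*\<close>
  continuous, hence measurable.

  By a Chernoff bound, outside an event of probability at most \<open>(log (1 / \<delta>))\<^sup>-\<^sup>2\<close> all empirical means
  over at least \<open>sqrt (log (1 / \<delta>))\<close> samples are within a fixed \<open>\<eta>\<close> of the true means. Then every
  Stage II iteration computes nearly \<open>w*(\<mu>)\<close>, so the second one at the latest satisfies the exit
  test, the pull counts are nearly \<open>\<alpha> w*(\<mu>) T*(\<mu>) log (1 / \<delta>)\<close>, and the statistic of Stage III is
  nearly \<open>\<alpha> log (1 / \<delta>)\<close>, which exceeds the threshold \<open>log (1 / \<delta>) (1 + o(1))\<close>.
\<close>

section \<open>Pairwise transportation costs\<close>

text \<open>The optimisation uses the divergence only through its form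
  \<open>B m - B a - a * (\<theta> m - \<theta> a)\<close> with \<theta> increasing and continuous;
  it is never differentiated. For the family, \<theta> inverts the mean map and \<open>B\<close> is
  the log-partition function in mean coordinates. Alternatives demand a strict inequality, so the
  inner infimum need not be attained; it is therefore handled through its lower bounds. The set of
  alternatives depends on the instance only through the designated index, which allows limits to be
  taken for one alternative at a time. Compactness yields continuity of the optimal weights but no
  modulus of continuity. Hence the accuracy \<eta> is fixed once, depending on \<alpha> and the
  instance, and does not shrink with \<delta>. The expectation also sees runs whose empirical means
  leave \<open>M\<close>, where divergence and weights take default values. Measurability must
  therefore cover the total functions.\<close>

definition pair_cost :: "(real \<Rightarrow> real \<Rightarrow> real) \<Rightarrow> real \<Rightarrow> real \<Rightarrow> real \<Rightarrow> real \<Rightarrow> real" where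
  "pair_cost d x y a c =
     x * d a ((x * a + y * c) / (x + y)) + y * d c ((x * a + y * c) / (x + y))"

lemma Zstat_eq_pair_cost: "Zstat d Ni Nj mi mj = pair_cost d (real Ni) (real Nj) mi mj"
  by (simp add: Zstat_def pair_cost_def Let_def)

lemma weighted_mean_in_interval:
  fixes M :: "real set"
  assumes "is_interval M" "a \<in> M" "c \<in> M" "0 \<le> x" "0 \<le> y" "0 < x + y"
  shows "(x * a + y * c) / (x + y) \<in> M"
proof -
  have "convex M" using assms(1) by (simp add: is_interval_convex)
  then have "(x / (x + y)) *\<^sub>R a + (y / (x + y)) *\<^sub>R c \<in> M"
    using assms by (intro convexD) (auto simp flip: add_divide_distrib)
  then show ?thesis by (simp add: add_divide_distrib)
qed

lemma pair_cost_scale: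
  assumes "s \<noteq> 0"
  shows "pair_cost d (s * x) (s * y) a c = s * pair_cost d x y a c"
proof -
  have "(s * x * a + s * y * c) / (s * x + s * y) = (x * a + y * c) / (x + y)"
  proof -
    have "s * x * a + s * y * c = s * (x * a + y * c)" "s * x + s * y = s * (x + y)"
      by (auto simp: algebra_simps)
    then show ?thesis using assms by simp
  qed
  then show ?thesis by (simp add: pair_cost_def algebra_simps)
qed

lemma other_index:
  fixes n k :: nat
  assumes "2 \<le> n"
  obtains j where "j < n" "j \<noteq> k"
proof (cases "k = 0")
  case True
  then show ?thesis using that[of 1] assms by simp
next
  case False
  then show ?thesis using that[of 0] assms by simp
qed

section \<open>Divergences of Bregman form in mean coordinates\<close>

locale bregman_divergence =
  fixes M :: "real set" and \<theta> B :: "real \<Rightarrow> real" and d :: "real \<Rightarrow> real \<Rightarrow> real"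
  assumes M_open: "open M" and M_interval: "is_interval M"
    and param_mono: "strict_mono_on M \<theta>"
    and param_cont: "continuous_on M \<theta>" and potential_cont: "continuous_on M B"
    and d_eq: "a \<in> M \<Longrightarrow> m \<in> M \<Longrightarrow> d a m = B m - B a - a * (\<theta> m - \<theta> a)"
    and d_nonneg: "a \<in> M \<Longrightarrow> m \<in> M \<Longrightarrow> 0 \<le> d a m"
begin

lemma d_self [simp]: "a \<in> M \<Longrightarrow> d a a = 0"
  by (simp add: d_eq)

text \<open>The law of cosines of Bregman divergences. Monotonicity, positivity and the compensation
  identity all rest on the sign or the cancellation of its cross term.\<close>

lemma three_point:
  "a \<in> M \<Longrightarrow> m \<in> M \<Longrightarrow> p \<in> M \<Longrightarrow> d a p = d a m + d m p + (a - m) * (\<theta> m - \<theta> p)"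
  by (simp add: d_eq algebra_simps)

lemma between_in_M: "a \<in> M \<Longrightarrow> c \<in> M \<Longrightarrow> a \<le> m \<Longrightarrow> m \<le> c \<Longrightarrow> m \<in> M"
  using M_interval unfolding is_interval_1 by blast

lemma d_mono_below:
  assumes "a \<in> M" "p \<in> M" "p \<le> m" "m \<le> a"
  shows "d a m \<le> d a p"
proof -
  have m: "m \<in> M" using assms between_in_M by blast
  have "\<theta> p \<le> \<theta> m"
    using strict_mono_on_leD[OF param_mono] assms m by blast
  then have "0 \<le> (a - m) * (\<theta> m - \<theta> p)" using assms by simp
  then show ?thesis using three_point[of a m p] d_nonneg[of m p] assms m by simp
qed

lemma d_mono_above:
  assumes "a \<in> M" "p \<in> M" "a \<le> m" "m \<le> p"
  shows "d a m \<le> d a p"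
proof -
  have m: "m \<in> M" using assms between_in_M by blast
  have "\<theta> m \<le> \<theta> p"
    using strict_mono_on_leD[OF param_mono] assms m by blast
  then have "0 \<le> (a - m) * (\<theta> m - \<theta> p)" using assms by (simp add: mult_nonpos_nonpos)
  then show ?thesis using three_point[of a m p] d_nonneg[of m p] assms m by simp
qed

text \<open>Only nonnegativity is assumed of \<open>d\<close>. Strictness comes from inserting the
  midpoint: there the cross term is positive because \<theta> is strictly increasing.\<close>

lemma d_pos:
  assumes a: "a \<in> M" and p: "p \<in> M" and ne: "a \<noteq> p"
  shows "0 < d a p"
proof -
  define m where "m = (a + p) / 2"
  have m: "m \<in> M"
    using between_in_M[OF a p, of m] between_in_M[OF p a, of m] by (cases "a \<le> p") (auto simp: m_def)
  have "0 < (a - m) * (\<theta> m - \<theta> p)"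
  proof (cases "a < p")
    case True
    then have "\<theta> m < \<theta> p" using strict_mono_onD[OF param_mono m p] by (auto simp: m_def)
    then show ?thesis using True by (intro mult_neg_neg) (auto simp: m_def field_simps)
  next
    case False
    then have "\<theta> p < \<theta> m" using ne strict_mono_onD[OF param_mono p m] by (auto simp: m_def)
    then show ?thesis using False ne by (intro mult_pos_pos) (auto simp: m_def field_simps)
  qed
  then show ?thesis
    using three_point[OF a m p] d_nonneg[OF a m] d_nonneg[OF m p] by linarith
qed

lemma tendsto_d:
  assumes "(f \<longlongrightarrow> a) F" "(g \<longlongrightarrow> m) F" "a \<in> M" "m \<in> M"
  shows "((\<lambda>s. d (f s) (g s)) \<longlongrightarrow> d a m) F"
proof -
  have c: "isCont \<theta> z" "isCont B z" if "z \<in> M" for z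
    using that param_cont potential_cont M_open by (auto simp: continuous_on_eq_continuous_at)
  have "((\<lambda>s. B (g s) - B (f s) - f s * (\<theta> (g s) - \<theta> (f s)))
      \<longlongrightarrow> B m - B a - a * (\<theta> m - \<theta> a)) F"
    using assms by (intro tendsto_intros isCont_tendsto_compose[where g=\<theta>] isCont_tendsto_compose[where g=B] c)
  moreover have "\<forall>\<^sub>F s in F. f s \<in> M" "\<forall>\<^sub>F s in F. g s \<in> M"
    using assms M_open topological_tendstoD by blast+
  then have "\<forall>\<^sub>F s in F. B (g s) - B (f s) - f s * (\<theta> (g s) - \<theta> (f s)) = d (f s) (g s)"
    by eventually_elim (simp add: d_eq)
  ultimately show ?thesis
    using assms(3,4) by (simp add: d_eq filterlim_cong[OF refl refl])
qed

text \<open>In the weighted sum of two three-point identities the cross terms cancel at the weighted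
  mean. This is the analogue of the parallel axis theorem: the weighted mean is the best common
  mean, and the excess of any other is explicit.\<close>

lemma compensation:
  assumes "a \<in> M" "c \<in> M" "m \<in> M" "0 \<le> x" "0 \<le> y" "0 < x + y"
  shows "x * d a m + y * d c m
       = pair_cost d x y a c + (x + y) * d ((x * a + y * c) / (x + y)) m"
proof -
  define p where "p = (x * a + y * c) / (x + y)"
  have p: "p \<in> M" unfolding p_def using assms M_interval by (intro weighted_mean_in_interval)
  have e: "(x + y) * p = x * a + y * c" using assms by (simp add: p_def)
  have "x * d a m + y * d c m - (x * d a p + y * d c p) - (x + y) * d p m
      = (x * (a - p) + y * (c - p)) * (\<theta> p - \<theta> m)"
    unfolding three_point[OF assms(1) p assms(3)] three_point[OF assms(2) p assms(3)]
    by (simp add: algebra_simps)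
  also have "x * (a - p) + y * (c - p) = 0" using e by (simp add: algebra_simps)
  finally show ?thesis by (simp add: pair_cost_def p_def)
qed

lemma pair_cost_le:
  assumes "a \<in> M" "c \<in> M" "m \<in> M" "0 \<le> x" "0 \<le> y"
  shows "pair_cost d x y a c \<le> x * d a m + y * d c m"
proof (cases "x + y = 0")
  \<comment> \<open>With both weights zero the mean is \<open>0 / 0 = 0\<close> and may lie outside
    \<open>M\<close>, but it is multiplied by zero.\<close>
  case True
  then have "x = 0" "y = 0" using assms by auto
  then show ?thesis by (simp add: pair_cost_def)
next
  case False
  then have "0 < x + y" using assms by auto
  moreover have "0 \<le> (x + y) * d ((x * a + y * c) / (x + y)) m"
    using assms M_interval calculation
    by (intro mult_nonneg_nonneg d_nonneg weighted_mean_in_interval) auto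
  ultimately show ?thesis using compensation[of a c m x y] assms by linarith
qed

text \<open>The minimising mean of the larger weights is still admissible for the smaller ones, and
  each term grows with its weight.\<close>

lemma pair_cost_mono:
  assumes "a \<in> M" "c \<in> M" "0 \<le> x" "0 \<le> y" "x \<le> x'" "y \<le> y'"
  shows "pair_cost d x y a c \<le> pair_cost d x' y' a c"
proof (cases "x' + y' = 0")
  case True
  then have "x = 0" "y = 0" "x' = 0" "y' = 0" using assms by auto
  then show ?thesis by simp
next
  case False
  define m where "m = (x' * a + y' * c) / (x' + y')"
  have m: "m \<in> M"
    unfolding m_def using assms False M_interval by (intro weighted_mean_in_interval) auto
  have "pair_cost d x y a c \<le> x * d a m + y * d c m"
    using assms m by (intro pair_cost_le)
  also have "\<dots> \<le> x' * d a m + y' * d c m"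
    using assms m by (intro add_mono mult_right_mono d_nonneg)
  finally show ?thesis by (simp add: pair_cost_def m_def)
qed

lemma pair_cost_pos:
  assumes "a \<in> M" "c \<in> M" "0 < x" "0 < y" "a \<noteq> c"
  shows "0 < pair_cost d x y a c"
proof -
  define m where "m = (x * a + y * c) / (x + y)"
  have m: "m \<in> M"
    unfolding m_def using assms M_interval by (intro weighted_mean_in_interval) auto
  have "m \<noteq> a"
  proof
    assume "m = a"
    then have "x * a + y * c = (x + y) * a" using assms by (simp add: m_def field_simps)
    then show False using assms by (simp add: algebra_simps)
  qed
  then have "0 < x * d a m" using assms m d_pos by simp
  moreover have "0 \<le> y * d c m" using assms m d_nonneg by simp
  ultimately show ?thesis by (simp add: pair_cost_def m_def)
qed

lemma pair_cost_zero:
  assumes "a \<in> M" "c \<in> M" "x = 0 \<or> y = 0"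
  shows "pair_cost d x y a c = 0"
  using assms by (cases "x = 0"; cases "y = 0") (auto simp: pair_cost_def)

text \<open>Superadditivity is strict unless the two weight pairs are proportional, because only
  then do they share their minimising mean.\<close>

lemma pair_cost_add_eq:
  assumes "a \<in> M" "c \<in> M" "a \<noteq> c" "0 < x" "0 < y" "0 < x'" "0 < y'"
    and le: "pair_cost d (x + x') (y + y') a c \<le> pair_cost d x y a c + pair_cost d x' y' a c"
  shows "y / x = y' / x'"
proof -
  define m where "m = ((x + x') * a + (y + y') * c) / ((x + x') + (y + y'))"
  define p where "p = (x * a + y * c) / (x + y)"
  define p' where "p' = (x' * a + y' * c) / (x' + y')"
  have M: "m \<in> M" "p \<in> M" "p' \<in> M"
    unfolding m_def p_def p'_def using assms M_interval
    by (auto intro!: weighted_mean_in_interval)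
  \<comment> \<open>Both pairs are charged at the joint mean \<open>m\<close>. Compensation then
    turns the assumed inequality into the vanishing of two divergences, so
    \<open>p = m = p'\<close>.\<close>
  have "pair_cost d (x + x') (y + y') a c = (x * d a m + y * d c m) + (x' * d a m + y' * d c m)"
    by (simp add: pair_cost_def m_def algebra_simps)
  also have "\<dots> = pair_cost d x y a c + (x + y) * d p m + pair_cost d x' y' a c + (x' + y') * d p' m"
    using assms M compensation[of a c m x y] compensation[of a c m x' y']
    by (simp add: p_def p'_def)
  finally have "(x + y) * d p m + (x' + y') * d p' m \<le> 0" using le by simp
  moreover have "0 \<le> (x + y) * d p m" "0 \<le> (x' + y') * d p' m"
    using assms M d_nonneg by simp_all
  ultimately have "(x + y) * d p m = 0" "(x' + y') * d p' m = 0" by linarith+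
  then have "d p m = 0" "d p' m = 0" using assms by auto
  then have "p = p'" using d_pos[OF M(2) M(1)] d_pos[OF M(3) M(1)] by force
  then have "(x * a + y * c) * (x' + y') = (x' * a + y' * c) * (x + y)"
    using assms by (simp add: p_def p'_def frac_eq_eq)
  then have "(y * x' - y' * x) * (c - a) = 0" by (simp add: algebra_simps)
  then have "y * x' = y' * x" using assms by simp
  then show ?thesis using assms by (simp add: frac_eq_eq)
qed

lemma tendsto_pair_cost:
  assumes "(x \<longlongrightarrow> x0) F" "(y \<longlongrightarrow> y0) F" "(a \<longlongrightarrow> a0) F" "(c \<longlongrightarrow> c0) F"
    "a0 \<in> M" "c0 \<in> M" "0 \<le> x0" "0 \<le> y0" "0 < x0 + y0"
  shows "((\<lambda>s. pair_cost d (x s) (y s) (a s) (c s)) \<longlongrightarrow> pair_cost d x0 y0 a0 c0) F"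
proof -
  have m: "((\<lambda>s. (x s * a s + y s * c s) / (x s + y s)) \<longlongrightarrow> (x0 * a0 + y0 * c0) / (x0 + y0)) F"
    using assms by (intro tendsto_divide tendsto_add tendsto_mult) auto
  have "(x0 * a0 + y0 * c0) / (x0 + y0) \<in> M"
    using assms M_interval by (intro weighted_mean_in_interval)
  then show ?thesis
    unfolding pair_cost_def using assms m by (intro tendsto_add tendsto_mult tendsto_d)
qed

section \<open>Optimal allocations\<close>

text \<open>Replacing the two means that change order by a common value between them does not
  increase the cost.\<close>

lemma pair_cost_le_swapped:
  assumes "a \<in> M" "c \<in> M" "c < a" "p \<in> M" "r \<in> M" "p < r" "0 \<le> x" "0 \<le> y"
  shows "pair_cost d x y a c \<le> x * d a p + y * d c r"
proof -
  \<comment> \<open>In all three cases the witness is \<open>p\<close> clamped to the interval from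
    \<open>c\<close> to \<open>a\<close>.\<close>
  have "\<exists>m\<in>M. d a m \<le> d a p \<and> d c m \<le> d c r"
  proof (cases "a \<le> p")
    case True
    then have "d c a \<le> d c r" using assms by (intro d_mono_above) auto
    then show ?thesis using assms d_nonneg by (intro bexI[of _ a]) auto
  next
    case False
    show ?thesis
    proof (cases "r \<le> c")
      case True
      then have "d a c \<le> d a p" using assms by (intro d_mono_below) auto
      then show ?thesis using assms d_nonneg by (intro bexI[of _ c]) auto
    next
      case c: False
      have "d a (max p c) \<le> d a p" using assms False by (intro d_mono_below) auto
      moreover have "d c (max p c) \<le> d c r" using assms c by (intro d_mono_above) auto
      moreover have "max p c \<in> M" using assms by (simp add: max_def)
      ultimately show ?thesis by blast
    qed
  qed
  then obtain m where m: "m \<in> M" "d a m \<le> d a p" "d c m \<le> d c r" by blast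
  have "pair_cost d x y a c \<le> x * d a m + y * d c m" using assms m by (intro pair_cost_le)
  also have "\<dots> \<le> x * d a p + y * d c r" using assms m by (intro add_mono mult_left_mono)
  finally show ?thesis .
qed

section \<open>The inner infimum as a minimum of pairwise costs\<close>

lemma Alt_cost_nonneg:
  assumes "valid_instance M n k lam" "\<forall>i<n. 0 \<le> w i" "lam' \<in> Alt M n k lam"
  shows "0 \<le> (\<Sum>i<n. w i * d (lam i) (lam' i))"
  using assms by (intro sum_nonneg mult_nonneg_nonneg d_nonneg) (auto simp: valid_instance_def Alt_def)

lemma Alt_nonempty:
  assumes "valid_instance M n k lam" "2 \<le> n"
  shows "Alt M n k lam \<noteq> {}"
proof -
  obtain j where j: "j < n" "j \<noteq> k" by (rule other_index[OF assms(2), of k])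
  have k: "k < n" using assms(1) by (simp add: valid_instance_def)
  have "lam(k := lam j, j := lam k) \<in> Alt M n k lam"
    using assms j k by (auto simp: Alt_def valid_instance_def intro!: exI[of _ j])
  then show ?thesis by blast
qed

text \<open>Every alternative reverses the order of some pair \<open>k\<close>, \<open>j\<close> and
  so pays at least the cost of that pair; conversely each pairwise cost is a limit of costs of
  alternatives. The bound \<open>z\<close> avoids naming a minimum over arms.\<close>

lemma alt_value_ge_iff:
  assumes v: "valid_instance M n k lam" and n: "2 \<le> n" and w: "\<forall>i<n. 0 \<le> w i"
  shows "z \<le> alt_value d M n k lam w \<longleftrightarrow>
    (\<forall>j<n. j \<noteq> k \<longrightarrow> z \<le> pair_cost d (w k) (w j) (lam k) (lam j))"
proof
  have k: "k < n" and lamM: "\<And>i. i < n \<Longrightarrow> lam i \<in> M" and lt: "\<And>j. j < n \<Longrightarrow> j \<noteq> k \<Longrightarrow> lam j < lam k"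
    using v by (auto simp: valid_instance_def)
  {
    assume z: "z \<le> alt_value d M n k lam w"
    show "\<forall>j<n. j \<noteq> k \<longrightarrow> z \<le> pair_cost d (w k) (w j) (lam k) (lam j)"
    proof (intro allI impI)
      fix j assume j: "j < n" "j \<noteq> k"
      show "z \<le> pair_cost d (w k) (w j) (lam k) (lam j)"
      proof -
        obtain m where m: "m \<in> M"
          "pair_cost d (w k) (w j) (lam k) (lam j) = w k * d (lam k) m + w j * d (lam j) m"
        proof (cases "w k + w j = 0")
          case True
          then have "w k = 0" "w j = 0" using w k j by (auto simp: add_nonneg_eq_0_iff)
          then show ?thesis using that[of "lam k"] lamM k by (simp add: pair_cost_def)
        next
          case False
          then have "0 < w k + w j" using w k j by (metis add_nonneg_nonneg less_eq_real_def)
          then show ?thesis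
            using that[of "(w k * lam k + w j * lam j) / (w k + w j)"] w k j lamM M_interval
            by (auto simp: pair_cost_def intro!: weighted_mean_in_interval)
        qed
        \<comment> \<open>Moving both arms to \<open>m\<close> gives no alternative, since arm
          \<open>j\<close> must strictly exceed arm \<open>k\<close>. So arm \<open>j\<close>
          approaches \<open>m\<close> from above.\<close>
        define h where "h = (\<lambda>s::nat. m + inverse (real (Suc s)))"
        have hl: "h \<longlonglongrightarrow> m"
          unfolding h_def using tendsto_add[OF tendsto_const LIMSEQ_inverse_real_of_nat, of m] by simp
        have "\<forall>\<^sub>F s in sequentially. h s \<in> M" using hl M_open m(1) topological_tendstoD by blast
        moreover have "z \<le> w k * d (lam k) m + w j * d (lam j) (h s)" if "h s \<in> M" for s
        proof -
          define l where "l = lam(k := m, j := h s)"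
          have "m < h s" by (simp add: h_def)
          then have l: "l \<in> Alt M n k lam"
            using j k m that lamM by (auto simp: Alt_def l_def intro!: exI[of _ j])
          have "z \<le> (\<Sum>i<n. w i * d (lam i) (l i))"
            using z l Alt_cost_nonneg[OF v w] unfolding alt_value_def
            by (metis (no_types, lifting) bdd_below.I2 cINF_lower order_trans)
          also have "\<dots> = (\<Sum>i\<in>{k, j}. w i * d (lam i) (l i))"
            using j k lamM by (intro sum.mono_neutral_right) (auto simp: l_def)
          also have "\<dots> = w k * d (lam k) m + w j * d (lam j) (h s)"
            using j by (simp add: l_def)
          finally show ?thesis .
        qed
        ultimately have "\<forall>\<^sub>F s in sequentially. z \<le> w k * d (lam k) m + w j * d (lam j) (h s)"
          by (auto elim: eventually_mono)
        moreover have "(\<lambda>s. w k * d (lam k) m + w j * d (lam j) (h s))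
            \<longlonglongrightarrow> w k * d (lam k) m + w j * d (lam j) m"
          using hl m j lamM by (intro tendsto_intros tendsto_d) auto
        ultimately have "z \<le> w k * d (lam k) m + w j * d (lam j) m"
          by (intro tendsto_lowerbound) auto
        then show ?thesis using m by simp
      qed
    qed
  }
  {
    assume z: "\<forall>j<n. j \<noteq> k \<longrightarrow> z \<le> pair_cost d (w k) (w j) (lam k) (lam j)"
    show "z \<le> alt_value d M n k lam w"
      unfolding alt_value_def
    proof (rule cINF_greatest)
      show "Alt M n k lam \<noteq> {}" using Alt_nonempty[OF v n] .
      fix l assume l: "l \<in> Alt M n k lam"
      then obtain j where j: "j < n" "j \<noteq> k" "l k < l j" and lM: "\<And>i. i < n \<Longrightarrow> l i \<in> M"
        by (auto simp: Alt_def)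
      have "z \<le> pair_cost d (w k) (w j) (lam k) (lam j)" using z j by blast
      also have "\<dots> \<le> w k * d (lam k) (l k) + w j * d (lam j) (l j)"
        using j k lM lamM lt w by (intro pair_cost_le_swapped) auto
      also have "\<dots> = (\<Sum>i\<in>{k, j}. w i * d (lam i) (l i))" using j by simp
      also have "\<dots> \<le> (\<Sum>i<n. w i * d (lam i) (l i))"
        using j k w lM lamM d_nonneg by (intro sum_mono2) auto
      finally show "z \<le> (\<Sum>i<n. w i * d (lam i) (l i))" .
    qed
  }
qed

lemma alt_value_le_Alt_cost:
  assumes "valid_instance M n k lam" "\<forall>i<n. 0 \<le> w i" "lam' \<in> Alt M n k lam"
  shows "alt_value d M n k lam w \<le> (\<Sum>i<n. w i * d (lam i) (lam' i))"
  unfolding alt_value_def using Alt_cost_nonneg[OF assms(1,2)] assms(3)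
  by (metis (no_types, lifting) bdd_below.I2 cINF_lower)

lemma prob_simplex_nonneg: "w \<in> prob_simplex n \<Longrightarrow> \<forall>i<n. 0 \<le> w i"
  by (simp add: prob_simplex_def)

lemma prob_simplex_le_1: "w \<in> prob_simplex n \<Longrightarrow> w i \<le> 1"
proof (cases "i < n")
  case True
  assume w: "w \<in> prob_simplex n"
  then have "w i \<le> (\<Sum>i<n. w i)"
    using True by (intro member_le_sum) (auto simp: prob_simplex_def)
  then show ?thesis using w by (simp add: prob_simplex_def)
qed (simp add: prob_simplex_def)

text \<open>One fixed alternative bounds the value for all weights at once, which makes the supremum
  in \<open>Tstar_inv\<close> a genuine one.\<close>

lemma bdd_above_alt_value:
  assumes "valid_instance M n k lam" "2 \<le> n"
  shows "bdd_above (alt_value d M n k lam ` prob_simplex n)"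
proof -
  obtain l where l: "l \<in> Alt M n k lam" using Alt_nonempty[OF assms] by blast
  have "alt_value d M n k lam w \<le> (\<Sum>i<n. d (lam i) (l i))" if w: "w \<in> prob_simplex n" for w
  proof -
    have "alt_value d M n k lam w \<le> (\<Sum>i<n. w i * d (lam i) (l i))"
      using alt_value_le_Alt_cost assms(1) l prob_simplex_nonneg[OF w] by blast
    also have "\<dots> \<le> (\<Sum>i<n. 1 * d (lam i) (l i))"
      using l assms(1) prob_simplex_le_1[OF w]
      by (intro sum_mono mult_right_mono d_nonneg) (auto simp: valid_instance_def Alt_def)
    finally show ?thesis by simp
  qed
  then show ?thesis by (intro bdd_aboveI2)
qed

lemma alt_value_le_Tstar_inv:
  assumes "valid_instance M n k lam" "2 \<le> n" "w \<in> prob_simplex n"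
  shows "alt_value d M n k lam w \<le> Tstar_inv d M n k lam"
  unfolding Tstar_inv_def using assms bdd_above_alt_value by (intro cSUP_upper) auto

lemma uniform_w_in_simplex: "2 \<le> n \<Longrightarrow> uniform_w n \<in> prob_simplex n"
  by (auto simp: prob_simplex_def uniform_w_def)

lemma Tstar_inv_pos:
  assumes v: "valid_instance M n k lam" and n: "2 \<le> n"
  shows "0 < Tstar_inv d M n k lam"
proof -
  define S where "S = (\<lambda>j. pair_cost d (1 / real n) (1 / real n) (lam k) (lam j)) ` ({..<n} - {k})"
  have k: "k < n" using v by (simp add: valid_instance_def)
  have "{..<n} - {k} \<noteq> {}" using other_index[OF n, of k] by auto
  then have "finite S" "S \<noteq> {}"
    by (auto simp: S_def)
  moreover have "\<forall>s\<in>S. 0 < s"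
    unfolding S_def using v n k by (auto simp: valid_instance_def intro!: pair_cost_pos)
  ultimately have "0 < Min S" by simp
  also have "Min S \<le> alt_value d M n k lam (uniform_w n)"
    using \<open>finite S\<close> k
    by (subst alt_value_ge_iff[OF v n]) (auto simp: uniform_w_def S_def intro!: Min_le)
  also have "\<dots> \<le> Tstar_inv d M n k lam"
    using v n uniform_w_in_simplex by (intro alt_value_le_Tstar_inv) auto
  finally show ?thesis .
qed

section \<open>Structure and uniqueness of optimal allocations\<close>

definition optimal_weights :: "nat \<Rightarrow> nat \<Rightarrow> (nat \<Rightarrow> real) \<Rightarrow> (nat \<Rightarrow> real) \<Rightarrow> bool" where
  "optimal_weights n k lam w \<longleftrightarrow>
     w \<in> prob_simplex n \<and> alt_value d M n k lam w = Tstar_inv d M n k lam"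

lemma optimal_weights_iff:
  assumes "valid_instance M n k lam" "2 \<le> n"
  shows "optimal_weights n k lam w \<longleftrightarrow> w \<in> prob_simplex n \<and>
    (\<forall>j<n. j \<noteq> k \<longrightarrow> Tstar_inv d M n k lam \<le> pair_cost d (w k) (w j) (lam k) (lam j))"
  unfolding optimal_weights_def
  using alt_value_le_Tstar_inv[OF assms, of w] alt_value_ge_iff[OF assms prob_simplex_nonneg, of w]
  by (metis order_antisym order_refl)

text \<open>A zero weight makes some pairwise cost with arm \<open>k\<close> vanish, against the
  positive optimum. Positivity is what the weight ratios in the uniqueness proof and the limits of
  pairwise costs rely on.\<close>

lemma optimal_weights_pos:
  assumes v: "valid_instance M n k lam" and n: "2 \<le> n" and w: "optimal_weights n k lam w" and i: "i < n"
  shows "0 < w i"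
proof (rule ccontr)
  assume "\<not> 0 < w i"
  moreover have W: "\<forall>i<n. 0 \<le> w i"
    using w prob_simplex_nonneg by (auto simp: optimal_weights_def)
  ultimately have wi: "w i = 0" using i by force
  obtain j where j: "j < n" "j \<noteq> k" "w k = 0 \<or> w j = 0"
  proof (cases "i = k")
    case True
    obtain j where "j < n" "j \<noteq> k" by (rule other_index[OF n, of k])
    then show ?thesis using that wi True by blast
  qed (use that wi i in blast)
  have "Tstar_inv d M n k lam \<le> pair_cost d (w k) (w j) (lam k) (lam j)"
    using w j by (simp add: optimal_weights_iff[OF v n])
  also have "\<dots> = 0" using j v by (intro pair_cost_zero) (auto simp: valid_instance_def)
  finally show False using Tstar_inv_pos[OF v n] by simp
qed

text \<open>If the cost of some arm exceeded the optimum, moving a little of its weight to all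
  arms proportionally would raise the minimum.\<close>

lemma optimal_weights_equalize:
  assumes v: "valid_instance M n k lam" and n: "2 \<le> n" and w: "optimal_weights n k lam w"
    and j: "j < n" "j \<noteq> k"
  shows "pair_cost d (w k) (w j) (lam k) (lam j) = Tstar_inv d M n k lam"
proof (rule ccontr)
  define V where "V = Tstar_inv d M n k lam"
  define I where "I = pair_cost d (w k) (w j) (lam k) (lam j)"
  assume "pair_cost d (w k) (w j) (lam k) (lam j) \<noteq> Tstar_inv d M n k lam"
  then have less: "V < I"
    using w j by (auto simp: optimal_weights_iff[OF v n] V_def I_def order_less_le)
  have V: "0 < V" using Tstar_inv_pos[OF v n] by (simp add: V_def)
  have k: "k < n" and lamM: "\<And>i. i < n \<Longrightarrow> lam i \<in> M" using v by (auto simp: valid_instance_def)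
  have ws: "w \<in> prob_simplex n" using w by (simp add: optimal_weights_def)
  have wpos: "\<And>i. i < n \<Longrightarrow> 0 < w i" using optimal_weights_pos[OF v n w] .
  \<comment> \<open>With this \<open>t\<close>, the reduced cost \<open>(1 - t) * I\<close> is the
    midpoint of \<open>V\<close> and \<open>I\<close>. The factor \<open>s\<close> below restores
    total weight one.\<close>
  define t where "t = (I - V) / (2 * I)"
  have t: "0 < t" "t < 1" "V < (1 - t) * I"
    using less V by (auto simp: t_def field_simps)
  have wj1: "w j \<le> 1" using prob_simplex_le_1[OF ws] .
  have "t * w j \<le> t" using wj1 t by (simp add: mult_left_le)
  then have tw: "0 < 1 - t * w j" "t * w j > 0" using t wpos[OF j(1)] by (linarith, simp)
  define s where "s = 1 / (1 - t * w j)"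
  have s: "1 < s" using tw by (simp add: s_def)
  define w' where "w' = (\<lambda>i. s * (if i = j then (1 - t) * w j else w i))"
  have "(\<Sum>i<n. if i = j then (1 - t) * w j else w i) = (\<Sum>i<n. w i) - t * w j"
  proof -
    have "(\<Sum>i<n. if i = j then (1 - t) * w j else w i) = (\<Sum>i<n. w i - (if i = j then t * w j else 0))"
      by (intro sum.cong) (auto simp: algebra_simps)
    also have "\<dots> = (\<Sum>i<n. w i) - t * w j" using j by (simp add: sum_subtractf)
    finally show ?thesis .
  qed
  then have "(\<Sum>i<n. w' i) = s * (1 - t * w j)"
    using ws unfolding w'_def by (simp add: prob_simplex_def flip: sum_distrib_left)
  also have "\<dots> = 1" using tw by (simp add: s_def)
  finally have "w' \<in> prob_simplex n"
    using ws s t j unfolding prob_simplex_def w'_def by auto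
  define z where "z = min (s * V) (s * ((1 - t) * I))"
  have "z \<le> alt_value d M n k lam w'"
  proof (subst alt_value_ge_iff[OF v n prob_simplex_nonneg[OF \<open>w' \<in> prob_simplex n\<close>]], intro allI impI)
    fix i assume i: "i < n" "i \<noteq> k"
    show "z \<le> pair_cost d (w' k) (w' i) (lam k) (lam i)"
    proof (cases "i = j")
      case True
      \<comment> \<open>Lowering only the weight of arm \<open>j\<close> loses no more than lowering
        both weights, and the latter is governed by homogeneity.\<close>
      have "(1 - t) * I = pair_cost d ((1 - t) * w k) ((1 - t) * w j) (lam k) (lam j)"
        using t by (simp add: I_def pair_cost_scale)
      also have "\<dots> \<le> pair_cost d (w k) ((1 - t) * w j) (lam k) (lam j)"
        using lamM k j t wpos[OF k] wpos[OF j(1)] by (intro pair_cost_mono) (auto simp: mult_left_le_one_le)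
      finally have "s * ((1 - t) * I) \<le> s * pair_cost d (w k) ((1 - t) * w j) (lam k) (lam j)"
        using s by simp
      then show ?thesis using True j s by (simp add: w'_def pair_cost_scale z_def min_le_iff_disj)
    next
      case False
      have "s * V \<le> s * pair_cost d (w k) (w i) (lam k) (lam i)"
        using w i s by (simp add: V_def optimal_weights_iff[OF v n])
      then show ?thesis using False j s i by (simp add: w'_def pair_cost_scale z_def min_le_iff_disj)
    qed
  qed
  also have "\<dots> \<le> V"
    unfolding V_def using v n \<open>w' \<in> prob_simplex n\<close> by (rule alt_value_le_Tstar_inv)
  finally have "z \<le> V" .
  moreover have "V < s * V" using s V by simp
  moreover have "(1 - t) * I < s * ((1 - t) * I)" using s V less t by simp
  then have "V < s * ((1 - t) * I)" using t by linarith
  ultimately show False by (simp add: z_def)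
qed

text \<open>By superadditivity the midpoint \<open>u\<close> of two optima costs at least
  \<open>V\<close> in every pair, so it is optimal and its costs are exactly \<open>V\<close>.
  Equality forces the ratios to arm \<open>k\<close> to agree, and total weight one fixes the
  scale.\<close>

lemma optimal_weights_unique:
  assumes v: "valid_instance M n k lam" and n: "2 \<le> n"
    and w: "optimal_weights n k lam w" and w': "optimal_weights n k lam w'"
  shows "w = w'"
proof -
  define V where "V = Tstar_inv d M n k lam"
  define u where "u = (\<lambda>i. (1/2) * (w i + w' i))"
  have k: "k < n" and lamM: "\<And>i. i < n \<Longrightarrow> lam i \<in> M"
    and lt: "\<And>j. j < n \<Longrightarrow> j \<noteq> k \<Longrightarrow> lam j < lam k" using v by (auto simp: valid_instance_def)
  note pos = optimal_weights_pos[OF v n w] optimal_weights_pos[OF v n w']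
  have ws: "w \<in> prob_simplex n" "w' \<in> prob_simplex n" using w w' by (simp_all add: optimal_weights_def)
  have us: "u \<in> prob_simplex n"
    using ws unfolding prob_simplex_def u_def
    by (auto simp: sum.distrib simp flip: sum_divide_distrib)
  have sup: "V \<le> pair_cost d (u k) (u j) (lam k) (lam j)
      \<and> (pair_cost d (u k) (u j) (lam k) (lam j) \<le> V \<longrightarrow> w j / w k = w' j / w' k)"
    if j: "j < n" "j \<noteq> k" for j
  proof -
    have "pair_cost d (w k) (w j) (lam k) (lam j) = V" "pair_cost d (w' k) (w' j) (lam k) (lam j) = V"
      using optimal_weights_equalize v n w w' j by (auto simp: V_def)
    moreover have "pair_cost d (u k) (u j) (lam k) (lam j)
        = (1/2) * pair_cost d (w k + w' k) (w j + w' j) (lam k) (lam j)"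
      unfolding u_def by (subst pair_cost_scale) auto
    moreover have "pair_cost d (w k) (w j) (lam k) (lam j) + pair_cost d (w' k) (w' j) (lam k) (lam j)
       \<le> pair_cost d (w k + w' k) (w j + w' j) (lam k) (lam j)"
    proof -
      define m where "m = ((w k + w' k) * lam k + (w j + w' j) * lam j) / ((w k + w' k) + (w j + w' j))"
      have m: "m \<in> M" unfolding m_def using pos k j lamM M_interval
        by (intro weighted_mean_in_interval) (auto intro!: add_pos_pos less_imp_le)
      have "pair_cost d (w k) (w j) (lam k) (lam j) \<le> w k * d (lam k) m + w j * d (lam j) m"
        "pair_cost d (w' k) (w' j) (lam k) (lam j) \<le> w' k * d (lam k) m + w' j * d (lam j) m"
        using pos(1)[OF k] pos(1)[OF j(1)] pos(2)[OF k] pos(2)[OF j(1)] lamM[OF k] lamM[OF j(1)] m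
        by (simp_all add: pair_cost_le)
      then show ?thesis by (simp add: pair_cost_def m_def algebra_simps)
    qed
    moreover have "pair_cost d (w k + w' k) (w j + w' j) (lam k) (lam j)
        \<le> pair_cost d (w k) (w j) (lam k) (lam j) + pair_cost d (w' k) (w' j) (lam k) (lam j)
      \<Longrightarrow> w j / w k = w' j / w' k"
      using pos k j lamM lt[OF j] by (intro pair_cost_add_eq[of "lam k" "lam j"]) auto
    ultimately show ?thesis by auto
  qed
  have u: "optimal_weights n k lam u"
    using us sup by (simp add: optimal_weights_iff[OF v n] V_def)
  have "w i / w k = w' i / w' k" if "i < n" for i
  proof (cases "i = k")
    case True
    then show ?thesis using pos(1)[OF k] pos(2)[OF k] by simp
  next
    case False
    then show ?thesis
      using sup[of i] that optimal_weights_equalize[OF v n u] by (simp add: V_def)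
  qed
  then have eq: "w i = w k / w' k * w' i" if "i < n" for i
    using that pos(1)[OF k] pos(2)[OF k] by (simp add: field_simps)
  have "1 = (\<Sum>i<n. w k / w' k * w' i)"
    using ws(1) eq by (simp add: prob_simplex_def)
  also have "\<dots> = w k / w' k" using ws(2) by (simp add: prob_simplex_def flip: sum_divide_distrib sum_distrib_left)
  finally have "w k / w' k = 1" by simp
  show "w = w'"
  proof
    fix i
    show "w i = w' i"
      using eq[of i] ws \<open>w k / w' k = 1\<close> by (cases "i < n") (simp_all add: prob_simplex_def)
  qed
qed

section \<open>Compactness, existence and continuity of optimal allocations\<close>

text \<open>Weights are functions on all naturals that vanish from \<open>n\<close> on, so
  compactness is taken from the product of the unit intervals over all naturals, which is
  metrizable.\<close>

lemma prob_simplex_sequentially_compact: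
  assumes "\<And>s. f s \<in> prob_simplex n"
  obtains w r where "w \<in> prob_simplex n" "strict_mono (r :: nat \<Rightarrow> nat)"
    "\<And>i. (\<lambda>s. f (r s) i) \<longlonglongrightarrow> w i"
proof -
  have "compactin (product_topology (\<lambda>i. euclidean) UNIV) (PiE UNIV (\<lambda>i::nat. {0..1::real}))"
    by (subst compactin_PiE) auto
  then have "compact (PiE UNIV (\<lambda>i::nat. {0..1::real}))"
    by (simp add: euclidean_product_topology)
  then have "seq_compact (PiE UNIV (\<lambda>i::nat. {0..1::real}))"
    by (simp add: compact_eq_seq_compact_metric)
  moreover have "\<forall>s. f s \<in> PiE UNIV (\<lambda>i::nat. {0..1::real})"
  proof (intro allI PiE_I)
    fix s i
    show "f s i \<in> {0..1}"
      using assms[of s] prob_simplex_le_1[OF assms[of s], of i] by (cases "i < n") (auto simp: prob_simplex_def)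
  qed simp
  ultimately obtain w r where w: "strict_mono (r :: nat \<Rightarrow> nat)" "(f \<circ> r) \<longlonglongrightarrow> w"
    by (rule seq_compactE)
  have lim: "(\<lambda>s. f (r s) i) \<longlonglongrightarrow> w i" for i
  proof -
    have "isCont (\<lambda>x::nat \<Rightarrow> real. x i) w"
      using continuous_on_product_coordinates[of i] continuous_on_eq_continuous_at[OF open_UNIV] by blast
    from isCont_tendsto_compose[OF this w(2)] show ?thesis by simp
  qed
  have "0 \<le> w i" if "i < n" for i
    using assms that by (intro LIMSEQ_le_const[OF lim]) (auto simp: prob_simplex_def)
  moreover have "(\<Sum>i<n. w i) = 1"
  proof -
    have "(\<lambda>s. \<Sum>i<n. f (r s) i) \<longlonglongrightarrow> (\<Sum>i<n. w i)" using lim by (intro tendsto_sum)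
    moreover have "(\<lambda>s. \<Sum>i<n. f (r s) i) = (\<lambda>s. 1)" using assms by (auto simp: prob_simplex_def)
    ultimately show ?thesis by (metis LIMSEQ_unique tendsto_const)
  qed
  moreover have "w i = 0" if "i \<ge> n" for i
  proof -
    have "(\<lambda>s. f (r s) i) = (\<lambda>s. 0)" using assms that by (auto simp: prob_simplex_def)
    then show ?thesis using lim[of i] by (simp add: LIMSEQ_const_iff)
  qed
  ultimately have "w \<in> prob_simplex n" by (auto simp: prob_simplex_def)
  then show ?thesis using that w lim by blast
qed

text \<open>All the instances share one set of alternatives, so the cost of each fixed alternative
  passes to the limit. Existence uses this with a constant instance, continuity with a varying
  one.\<close>

lemma optimal_weights_limit:
  assumes v: "valid_instance M n k lam" and n: "2 \<le> n" and w: "w \<in> prob_simplex n"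
    and vs: "\<And>s. valid_instance M n k (l s)" and ws: "\<And>s. f s \<in> prob_simplex n"
    and fl: "\<And>i. i < n \<Longrightarrow> (\<lambda>s. f s i) \<longlonglongrightarrow> w i" and ll: "\<And>i. i < n \<Longrightarrow> (\<lambda>s. l s i) \<longlonglongrightarrow> lam i"
    and bound: "\<And>e. 0 < e \<Longrightarrow> \<forall>\<^sub>F s in sequentially. Tstar_inv d M n k lam - e \<le> alt_value d M n k (l s) (f s)"
  shows "optimal_weights n k lam w"
proof -
  have "Tstar_inv d M n k lam \<le> alt_value d M n k lam w"
    unfolding alt_value_def
  proof (rule cINF_greatest)
    show "Alt M n k lam \<noteq> {}" using Alt_nonempty[OF v n] .
    fix p assume p: "p \<in> Alt M n k lam"
    show "Tstar_inv d M n k lam \<le> (\<Sum>i<n. w i * d (lam i) (p i))"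
    proof (rule field_le_epsilon)
      fix e :: real assume e: "0 < e"
      have lim: "(\<lambda>s. \<Sum>i<n. f s i * d (l s i) (p i)) \<longlonglongrightarrow> (\<Sum>i<n. w i * d (lam i) (p i))"
        using fl ll p v by (intro tendsto_intros tendsto_d) (auto simp: Alt_def valid_instance_def)
      have "\<forall>\<^sub>F s in sequentially. Tstar_inv d M n k lam - e \<le> (\<Sum>i<n. f s i * d (l s i) (p i))"
        using bound[OF e]
      proof eventually_elim
        case (elim s)
        have "p \<in> Alt M n k (l s)" using p by (simp add: Alt_def)
        then show ?case
          using alt_value_le_Alt_cost[OF vs prob_simplex_nonneg[OF ws]] elim order_trans by blast
      qed
      then have "Tstar_inv d M n k lam - e \<le> (\<Sum>i<n. w i * d (lam i) (p i))"
        by (intro tendsto_lowerbound[OF lim]) auto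
      then show "Tstar_inv d M n k lam \<le> (\<Sum>i<n. w i * d (lam i) (p i)) + e" by simp
    qed
  qed
  then show ?thesis
    using alt_value_le_Tstar_inv[OF v n w] w by (simp add: optimal_weights_def)
qed

lemma optimal_weights_exist:
  assumes v: "valid_instance M n k lam" and n: "2 \<le> n"
  obtains w where "optimal_weights n k lam w"
proof -
  define V where "V = Tstar_inv d M n k lam"
  have "\<exists>w\<in>prob_simplex n. V - inverse (real (Suc s)) < alt_value d M n k lam w" for s
  proof -
    have "V - inverse (real (Suc s)) < (SUP w\<in>prob_simplex n. alt_value d M n k lam w)"
      by (simp add: V_def Tstar_inv_def)
    then show ?thesis
      using uniform_w_in_simplex[OF n] bdd_above_alt_value[OF v n]
      by (subst (asm) less_cSUP_iff) auto
  qed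
  then obtain f where f: "\<And>s. f s \<in> prob_simplex n"
    "\<And>s. V - inverse (real (Suc s)) < alt_value d M n k lam (f s)" by metis
  obtain w r where w: "w \<in> prob_simplex n" "strict_mono r" "\<And>i. (\<lambda>s. f (r s) i) \<longlonglongrightarrow> w i"
    using prob_simplex_sequentially_compact[of f n] f(1) by metis
  have "optimal_weights n k lam w"
  proof (rule optimal_weights_limit[OF v n w(1), of "\<lambda>s. lam" "\<lambda>s. f (r s)"])
    fix e :: real assume "0 < e"
    then have "\<forall>\<^sub>F s in sequentially. inverse (real (Suc s)) < e"
      by (rule order_tendstoD(2)[OF LIMSEQ_inverse_real_of_nat])
    then have "\<forall>\<^sub>F s in sequentially. inverse (real (Suc (r s))) < e"
      by (rule eventually_subseq[OF w(2)])
    then show "\<forall>\<^sub>F s in sequentially. Tstar_inv d M n k lam - e \<le> alt_value d M n k lam (f (r s))"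
    proof eventually_elim
      case (elim s)
      then show ?case using f(2)[of "r s"] by (simp add: V_def)
    qed
  qed (use v f w in auto)
  then show ?thesis using that by blast
qed

lemma wstar_optimal:
  assumes v: "valid_instance M n k lam" and n: "2 \<le> n"
  shows "optimal_weights n k lam (wstar d M n k lam)"
proof -
  have "wstar d M n k lam = (SOME w. optimal_weights n k lam w)"
    using v by (simp add: wstar_def optimal_weights_def)
  then show ?thesis using optimal_weights_exist[OF v n] by (metis someI)
qed

text \<open>The argument of Berge's maximum theorem with a unique maximiser: \<open>w\<close> stays
  nearly optimal for nearby instances, hence every subsequential limit of their maximisers is
  optimal for \<open>lam\<close> and equals \<open>w\<close>. Equalisation identifies the optimum
  with a single pairwise cost, which carries continuity over to \<open>Tstar_inv\<close>.\<close>

lemma wstar_and_Tstar_inv_continuous: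
  assumes v: "valid_instance M n k lam" and n: "2 \<le> n"
    and vs: "\<And>s. valid_instance M n k (l s)"
    and ll: "\<And>i. i < n \<Longrightarrow> (\<lambda>s. l s i) \<longlonglongrightarrow> lam i"
  shows "(\<lambda>s. wstar d M n k (l s) i) \<longlonglongrightarrow> wstar d M n k lam i"
    and "(\<lambda>s. Tstar_inv d M n k (l s)) \<longlonglongrightarrow> Tstar_inv d M n k lam"
proof -
  define V where "V = Tstar_inv d M n k lam"
  define w where "w = wstar d M n k lam"
  define f where "f = (\<lambda>s. wstar d M n k (l s))"
  have k: "k < n" and lamM: "\<And>i. i < n \<Longrightarrow> lam i \<in> M" using v by (auto simp: valid_instance_def)
  have w: "optimal_weights n k lam w" using wstar_optimal[OF v n] by (simp add: w_def)
  have f: "optimal_weights n k (l s) (f s)" for s using wstar_optimal[OF vs n] by (simp add: f_def)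
  have wpos: "\<And>i. i < n \<Longrightarrow> 0 < w i" using optimal_weights_pos[OF v n w] .
  have ws: "w \<in> prob_simplex n" "\<And>s. f s \<in> prob_simplex n"
    using w f by (simp_all add: optimal_weights_def)
  have bound: "\<forall>\<^sub>F s in sequentially. V - e \<le> alt_value d M n k (l s) (f s)" if e: "0 < e" for e
  proof -
    have "\<forall>\<^sub>F s in sequentially. \<forall>j\<in>{..<n} - {k}. V - e < pair_cost d (w k) (w j) (l s k) (l s j)"
    proof (intro eventually_ball_finite ballI)
      fix j assume j: "j \<in> {..<n} - {k}"
      have "(\<lambda>s. pair_cost d (w k) (w j) (l s k) (l s j)) \<longlonglongrightarrow> pair_cost d (w k) (w j) (lam k) (lam j)"
        using j k ll lamM wpos by (intro tendsto_pair_cost tendsto_const) (auto intro: less_imp_le add_pos_pos)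
      moreover have "pair_cost d (w k) (w j) (lam k) (lam j) = V"
        using optimal_weights_equalize[OF v n w] j by (simp add: V_def)
      ultimately show "\<forall>\<^sub>F s in sequentially. V - e < pair_cost d (w k) (w j) (l s k) (l s j)"
        using e by (intro order_tendstoD) auto
    qed simp
    then show ?thesis
    proof eventually_elim
      case (elim s)
      have "V - e \<le> alt_value d M n k (l s) w"
        using elim by (subst alt_value_ge_iff[OF vs n prob_simplex_nonneg[OF ws(1)]]) (auto intro: less_imp_le)
      also have "\<dots> \<le> alt_value d M n k (l s) (f s)"
        using alt_value_le_Tstar_inv[OF vs n ws(1)] f by (simp add: optimal_weights_def)
      finally show ?case .
    qed
  qed
  have lim: "(\<lambda>s. f s i) \<longlonglongrightarrow> w i" for i
  proof (rule ccontr)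
    assume "\<not> (\<lambda>s. f s i) \<longlonglongrightarrow> w i"
    then obtain e where e: "0 < e" "\<And>N. \<exists>s\<ge>N. e \<le> dist (f s i) (w i)"
      unfolding lim_sequentially by (auto simp: not_less)
    have "infinite {s. e \<le> dist (f s i) (w i)}"
      unfolding infinite_nat_iff_unbounded_le using e(2) by auto
    then obtain q :: "nat \<Rightarrow> nat" where q: "strict_mono q" "\<And>s. e \<le> dist (f (q s) i) (w i)"
      by (metis infinite_enumerate mem_Collect_eq)
    obtain u r where u: "u \<in> prob_simplex n" "strict_mono r" "\<And>i. (\<lambda>s. f (q (r s)) i) \<longlonglongrightarrow> u i"
      using prob_simplex_sequentially_compact[of "\<lambda>s. f (q s)"] ws by metis
    have qr: "strict_mono (\<lambda>s. q (r s))" using q u by (simp add: strict_mono_def)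
    have "optimal_weights n k lam u"
    proof (rule optimal_weights_limit[OF v n u(1), of "\<lambda>s. l (q (r s))" "\<lambda>s. f (q (r s))"])
      show "(\<lambda>s. l (q (r s)) i) \<longlonglongrightarrow> lam i" if "i < n" for i
        using LIMSEQ_subseq_LIMSEQ[OF ll[OF that] qr] by (simp add: comp_def)
      show "\<forall>\<^sub>F s in sequentially. Tstar_inv d M n k lam - e
            \<le> alt_value d M n k (l (q (r s))) (f (q (r s)))" if "0 < e" for e
        using eventually_subseq[OF qr bound[OF that]] by (simp add: V_def)
    qed (use vs ws u in auto)
    then have "u = w" using optimal_weights_unique[OF v n _ w] by blast
    then have "\<forall>\<^sub>F s in sequentially. dist (f (q (r s)) i) (w i) < e"
      using u(3)[of i] e(1) by (auto intro: tendstoD)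
    then obtain s where "dist (f (q (r s)) i) (w i) < e" by (auto simp: eventually_sequentially)
    then show False using q(2)[of "r s"] by simp
  qed
  then show "(\<lambda>s. wstar d M n k (l s) i) \<longlonglongrightarrow> wstar d M n k lam i" by (simp add: f_def w_def)
  obtain j where j: "j < n" "j \<noteq> k" by (rule other_index[OF n, of k])
  have "(\<lambda>s. pair_cost d (f s k) (f s j) (l s k) (l s j)) \<longlonglongrightarrow> pair_cost d (w k) (w j) (lam k) (lam j)"
    using j k ll lamM wpos lim by (intro tendsto_pair_cost) (auto intro: less_imp_le add_pos_pos)
  then show "(\<lambda>s. Tstar_inv d M n k (l s)) \<longlonglongrightarrow> Tstar_inv d M n k lam"
    using optimal_weights_equalize[OF v n w j] optimal_weights_equalize[OF vs n f j] by simp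
qed

end

section \<open>The exponential family\<close>

lemma exp_minus_linear_bound:
  fixes y :: real
  shows "\<bar>exp y - 1 - y\<bar> \<le> y\<^sup>2 * exp \<bar>y\<bar>"
proof -
  have ge: "0 \<le> exp y - 1 - y" using exp_ge_add_one_self[of y] by linarith
  have "(1 - y) * exp y \<le> exp (- y) * exp y"
    using exp_ge_add_one_self[of "- y"] by (intro mult_right_mono) auto
  then have e: "exp y - 1 \<le> y * exp y" by (simp add: algebra_simps flip: exp_add)
  have "exp y - 1 - y \<le> y * (exp y - 1)" using e by (simp add: algebra_simps)
  also have "\<dots> \<le> y\<^sup>2 * exp \<bar>y\<bar>"
  proof (cases "0 \<le> y")
    case True
    then have "y * (exp y - 1) \<le> y * (y * exp y)" using e by (intro mult_left_mono)
    then show ?thesis using True by (simp add: power2_eq_square mult.assoc)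
  next
    case False
    then have "(- y) * (1 - exp y) \<le> (- y) * (- y)"
      using exp_ge_add_one_self[of y] by (intro mult_left_mono) linarith+
    also have "\<dots> \<le> y\<^sup>2 * exp \<bar>y\<bar>"
      by (simp add: power2_eq_square mult_le_cancel_left1)
    finally show ?thesis by (simp add: algebra_simps)
  qed
  finally show ?thesis using ge by simp
qed

text \<open>The rate \<open>r\<close> is spent in thirds: with
  \<open>y = r / 3 * \<bar>x\<bar>\<close>, the square costs two of them through
  \<open>y\<^sup>2 \<le> exp (2 * y)\<close>, and \<open>exp \<bar>h * x\<bar>\<close> costs the
  last.\<close>

lemma square_exp_bound:
  fixes x h r :: real
  assumes "0 < r" "\<bar>h\<bar> \<le> r / 3"
  shows "x\<^sup>2 * exp \<bar>h * x\<bar> \<le> 9 / r\<^sup>2 * (exp (x * r) + exp (- (x * r)))"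
proof -
  define y where "y = r / 3 * \<bar>x\<bar>"
  have y0: "0 \<le> y" using assms by (simp add: y_def)
  have "y \<le> exp y" using exp_ge_add_one_self[of y] by linarith
  then have "y\<^sup>2 \<le> (exp y)\<^sup>2" using y0 by (intro power_mono)
  then have y2: "y\<^sup>2 \<le> exp (2 * y)" by (simp add: exp_double)
  have "\<bar>h * x\<bar> \<le> y" unfolding y_def abs_mult using assms by (intro mult_right_mono) auto
  then have "y\<^sup>2 * exp \<bar>h * x\<bar> \<le> exp (2 * y) * exp y" using y2 by (intro mult_mono) auto
  also have "\<dots> = exp (r * \<bar>x\<bar>)" by (simp add: y_def flip: exp_add)
  also have "\<dots> \<le> exp (x * r) + exp (- (x * r))" by (cases "0 \<le> x") (auto simp: mult.commute)
  finally have "9 / r\<^sup>2 * (y\<^sup>2 * exp \<bar>h * x\<bar>) \<le> 9 / r\<^sup>2 * (exp (x * r) + exp (- (x * r)))"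
    by (intro mult_left_mono) auto
  moreover have "9 / r\<^sup>2 * y\<^sup>2 = x\<^sup>2"
    using assms by (simp add: y_def power2_eq_square field_simps)
  then have "9 / r\<^sup>2 * (y\<^sup>2 * exp \<bar>h * x\<bar>) = x\<^sup>2 * exp \<bar>h * x\<bar>"
    by (simp only: mult.assoc[symmetric])
  ultimately show ?thesis by simp
qed

text \<open>A remainder bound uniform in \<open>h\<close> takes the place of dominated convergence
  when \<open>Z\<close> is differentiated.\<close>

lemma DERIV_of_quadratic_bound:
  fixes f :: "real \<Rightarrow> real"
  assumes "0 < r" and bound: "\<And>h. \<bar>h\<bar> \<le> r \<Longrightarrow> \<bar>f (x + h) - f x - h * D\<bar> \<le> K * h\<^sup>2"
  shows "(f has_real_derivative D) (at x)"
proof -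
  have "((\<lambda>h. (f (x + h) - f x) / h - D) \<longlongrightarrow> 0) (at 0)"
  proof (rule Lim_null_comparison)
    show "\<forall>\<^sub>F h in at 0. norm ((f (x + h) - f x) / h - D) \<le> K * \<bar>h\<bar>"
      unfolding eventually_at
    proof (intro exI[of _ r] conjI ballI impI)
      fix h :: real assume h: "h \<noteq> 0 \<and> dist h 0 < r"
      have "\<bar>(f (x + h) - f x) / h - D\<bar> = \<bar>f (x + h) - f x - h * D\<bar> / \<bar>h\<bar>"
        using h by (simp add: field_simps flip: abs_divide)
      also have "\<dots> \<le> K * h\<^sup>2 / \<bar>h\<bar>" using bound[of h] h by (intro divide_right_mono) auto
      also have "\<dots> = K * \<bar>h\<bar>" using h by (simp add: power2_eq_square abs_if)
      finally show "norm ((f (x + h) - f x) / h - D) \<le> K * \<bar>h\<bar>" by simp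
    qed fact
    show "((\<lambda>h. K * \<bar>h\<bar>) \<longlongrightarrow> 0) (at 0)"
      by (intro tendsto_eq_intros) auto
  qed
  then show ?thesis by (simp add: has_field_derivative_def DERIV_def LIM_zero_iff flip: has_field_derivative_def)
qed

locale expfam =
  fixes \<rho> :: "real measure" and \<Theta> M :: "real set"
  assumes fam: "canonical_expfam \<rho> \<Theta> M"
begin

abbreviation "b \<equiv> ef_b \<rho>"
abbreviation "Z \<equiv> \<lambda>\<theta>. \<integral>x. exp (x * \<theta>) \<partial>\<rho>"

lemma sets_rho [simp, measurable_cong]: "sets \<rho> = sets borel"
  using fam by (simp add: canonical_expfam_def)

lemma space_rho [simp]: "space \<rho> = UNIV"
  using sets_eq_imp_space_eq[OF sets_rho] by simp

lemma exp_integrable: "\<theta> \<in> \<Theta> \<Longrightarrow> integrable \<rho> (\<lambda>x. exp (x * \<theta>))"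
  using fam by (simp add: canonical_expfam_def)

lemma Theta_ball:
  assumes "\<theta> \<in> \<Theta>"
  obtains r where "0 < r" "\<forall>h. \<bar>h\<bar> \<le> r \<longrightarrow> \<theta> + h \<in> \<Theta>"
proof -
  have "open \<Theta>" using fam by (simp add: canonical_expfam_def)
  then obtain r where r: "0 < r" "cball \<theta> r \<subseteq> \<Theta>" using assms open_contains_cball by blast
  have "\<theta> + h \<in> \<Theta>" if "\<bar>h\<bar> \<le> r" for h
    using r(2) that by (auto simp: dist_real_def)
  then show ?thesis using that r(1) by blast
qed

lemma inj_deriv: "inj_on (deriv b) \<Theta>"
  and deriv_image: "deriv b ` \<Theta> = M"
  using fam by (auto simp: canonical_expfam_def bij_betw_def)

text \<open>Otherwise \<rho> is null, all integrals vanish, and \<open>ef_b\<close> is constant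
  because \<open>ln 0 = 0\<close> by convention. This contradicts the injectivity of the mean map,
  as the open set \<Theta> contains two points.\<close>

lemma Z_pos:
  assumes t: "\<theta> \<in> \<Theta>"
  shows "0 < Z \<theta>"
proof (rule ccontr)
  assume "\<not> 0 < Z \<theta>"
  moreover have "0 \<le> Z \<theta>" by (intro integral_nonneg_AE) auto
  ultimately have "Z \<theta> = 0" by simp
  then have "AE x in \<rho>. exp (x * \<theta>) = 0"
    using integral_nonneg_eq_0_iff_AE[OF exp_integrable[OF t]] by simp
  then have null: "AE x in \<rho>. False" by simp
  have "Z s = 0" for s
  proof -
    have "Z s = (\<integral>x. 0 \<partial>\<rho>)"
      using null by (intro integral_cong_AE) auto
    then show ?thesis by simp
  qed
  then have "b = (\<lambda>s. 0)" by (auto simp: ef_b_def)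
  then have const: "deriv b s = 0" for s by simp
  obtain r where "0 < r" "\<forall>h. \<bar>h\<bar> \<le> r \<longrightarrow> \<theta> + h \<in> \<Theta>" by (rule Theta_ball[OF t])
  then have "\<theta> + r \<in> \<Theta>" "\<theta> + r \<noteq> \<theta>" by auto
  then show False using inj_deriv t const by (metis inj_onD)
qed

lemma Z_eq_exp: "\<theta> \<in> \<Theta> \<Longrightarrow> Z \<theta> = exp (b \<theta>)"
  using Z_pos by (simp add: ef_b_def)

lemma Z_derivative:
  assumes t: "\<theta> \<in> \<Theta>"
  shows "integrable \<rho> (\<lambda>x. x * exp (x * \<theta>))"
    and "(Z has_real_derivative (\<integral>x. x * exp (x * \<theta>) \<partial>\<rho>)) (at \<theta>)"
proof -
  obtain r where r: "0 < r" "\<forall>h. \<bar>h\<bar> \<le> r \<longrightarrow> \<theta> + h \<in> \<Theta>" by (rule Theta_ball[OF t])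
  \<comment> \<open>The majorant is integrable because both \<open>\<theta> + r\<close> and
    \<open>\<theta> - r\<close> lie in \<Theta>.\<close>
  define D where "D x = 9 / r\<^sup>2 * (exp (x * (\<theta> + r)) + exp (x * (\<theta> + - r)))" for x
  have D: "integrable \<rho> D"
    unfolding D_def using exp_integrable[OF r(2)[rule_format, of r]]
      exp_integrable[OF r(2)[rule_format, of "- r"]] r(1)
    by (intro integrable_mult_right Bochner_Integration.integrable_add) auto
  have D_eq: "exp (x * \<theta>) * (9 / r\<^sup>2 * (exp (x * r) + exp (- (x * r)))) = D x" for x
  proof -
    have "exp (x * (\<theta> + r)) = exp (x * \<theta>) * exp (x * r)"
      "exp (x * (\<theta> + - r)) = exp (x * \<theta>) * exp (- (x * r))"
      by (simp_all add: algebra_simps flip: exp_add)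
    then show ?thesis unfolding D_def by (simp only: ring_distribs ac_simps)
  qed
  have sq: "exp (x * \<theta>) * (x\<^sup>2 * exp \<bar>h * x\<bar>) \<le> D x" if "\<bar>h\<bar> \<le> r / 3" for x h
    unfolding D_eq[symmetric] using square_exp_bound[OF r(1) that] by (intro mult_left_mono) auto
  show int: "integrable \<rho> (\<lambda>x. x * exp (x * \<theta>))"
  proof (rule Bochner_Integration.integrable_bound)
    show "integrable \<rho> (\<lambda>x. exp (x * \<theta>) + D x)" using D exp_integrable[OF t] by simp
    show "AE x in \<rho>. norm (x * exp (x * \<theta>)) \<le> norm (exp (x * \<theta>) + D x)"
    proof (rule AE_I2)
      fix x :: real
      have "\<bar>x\<bar> \<le> 1 + x\<^sup>2"
      proof (cases "\<bar>x\<bar> \<le> 1")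
        case False
        then have "\<bar>x\<bar> * 1 \<le> \<bar>x\<bar> * \<bar>x\<bar>" by (intro mult_left_mono) auto
        then show ?thesis by (simp add: power2_eq_square)
      qed (simp add: add_increasing2)
      then have "\<bar>x\<bar> * exp (x * \<theta>) \<le> (1 + x\<^sup>2) * exp (x * \<theta>)" by (intro mult_right_mono) auto
      also have "\<dots> \<le> exp (x * \<theta>) + D x" using sq[of 0 x] r by (simp add: algebra_simps)
      finally show "norm (x * exp (x * \<theta>)) \<le> norm (exp (x * \<theta>) + D x)" by (simp add: abs_mult)
    qed
  qed simp
  show "(Z has_real_derivative (\<integral>x. x * exp (x * \<theta>) \<partial>\<rho>)) (at \<theta>)"
  proof (rule DERIV_of_quadratic_bound)
    show "0 < r / 3" using r by simp
    fix h :: real assume h: "\<bar>h\<bar> \<le> r / 3"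
    then have th: "\<theta> + h \<in> \<Theta>" using r by simp
    note ints = exp_integrable[OF th] exp_integrable[OF t] int
    have "Z (\<theta> + h) - Z \<theta> - h * (\<integral>x. x * exp (x * \<theta>) \<partial>\<rho>)
        = (\<integral>x. exp (x * (\<theta> + h)) - exp (x * \<theta>) - h * (x * exp (x * \<theta>)) \<partial>\<rho>)"
      using ints by simp
    also have "\<bar>\<dots>\<bar> \<le> (\<integral>x. h\<^sup>2 * D x \<partial>\<rho>)"
    proof (rule integral_abs_bound_integral)
      show "integrable \<rho> (\<lambda>x. exp (x * (\<theta> + h)) - exp (x * \<theta>) - h * (x * exp (x * \<theta>)))"
        using ints by simp
      show "integrable \<rho> (\<lambda>x. h\<^sup>2 * D x)" using D by simp
      fix x
      have "exp (x * (\<theta> + h)) - exp (x * \<theta>) - h * (x * exp (x * \<theta>))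
          = exp (x * \<theta>) * (exp (h * x) - 1 - h * x)"
        by (simp add: exp_add algebra_simps)
      also have "\<bar>\<dots>\<bar> \<le> exp (x * \<theta>) * ((h * x)\<^sup>2 * exp \<bar>h * x\<bar>)"
        using exp_minus_linear_bound[of "h * x"] by (simp add: abs_mult)
      also have "\<dots> = h\<^sup>2 * (exp (x * \<theta>) * (x\<^sup>2 * exp \<bar>h * x\<bar>))"
        by (simp add: power_mult_distrib)
      also have "\<dots> \<le> h\<^sup>2 * D x" using sq[OF h] by (intro mult_left_mono) auto
      finally show "\<bar>exp (x * (\<theta> + h)) - exp (x * \<theta>) - h * (x * exp (x * \<theta>))\<bar> \<le> h\<^sup>2 * D x" .
    qed
    also have "\<dots> = (\<integral>x. D x \<partial>\<rho>) * h\<^sup>2" by simp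
    finally show "\<bar>Z (\<theta> + h) - Z \<theta> - h * (\<integral>x. x * exp (x * \<theta>) \<partial>\<rho>)\<bar> \<le> (\<integral>x. D x \<partial>\<rho>) * h\<^sup>2" .
  qed
qed

lemma b_derivative:
  assumes "\<theta> \<in> \<Theta>"
  shows "(b has_real_derivative ((\<integral>x. x * exp (x * \<theta>) \<partial>\<rho>) / Z \<theta>)) (at \<theta>)"
  unfolding ef_b_def[abs_def]
  using Z_derivative(2)[OF assms] Z_pos[OF assms] by (auto intro!: derivative_eq_intros)

lemma b_deriv:
  assumes "\<theta> \<in> \<Theta>"
  shows "(b has_real_derivative deriv b \<theta>) (at \<theta>)"
  using b_derivative[OF assms] by (simp add: DERIV_imp_deriv)

lemma integral_nu:
  fixes f :: "real \<Rightarrow> real"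
  assumes [measurable]: "f \<in> borel_measurable borel"
  shows "(\<integral>x. f x \<partial>ef_nu \<rho> \<theta>) = (\<integral>x. exp (x * \<theta> - b \<theta>) * f x \<partial>\<rho>)"
    and "integrable (ef_nu \<rho> \<theta>) f \<longleftrightarrow> integrable \<rho> (\<lambda>x. exp (x * \<theta> - b \<theta>) * f x)"
  unfolding ef_nu_def by (subst integral_density integrable_density; simp)+

lemma sets_nu [simp, measurable_cong]: "sets (ef_nu \<rho> \<theta>) = sets borel"
  by (simp add: ef_nu_def)

lemma exp_shift: "exp (x * \<theta> - b \<theta>) * exp (x * h) = exp (- b \<theta>) * exp (x * (\<theta> + h))"
  by (simp add: algebra_simps flip: exp_add)

lemma nu_mgf:
  assumes "\<theta> \<in> \<Theta>" "\<theta> + h \<in> \<Theta>"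
  shows "integrable (ef_nu \<rho> \<theta>) (\<lambda>x. exp (x * h))"
    and "(\<integral>x. exp (x * h) \<partial>ef_nu \<rho> \<theta>) = exp (b (\<theta> + h) - b \<theta>)"
proof -
  show "integrable (ef_nu \<rho> \<theta>) (\<lambda>x. exp (x * h))"
    using exp_integrable[OF assms(2)] by (simp add: integral_nu exp_shift)
  have "(\<integral>x. exp (x * h) \<partial>ef_nu \<rho> \<theta>) = exp (- b \<theta>) * Z (\<theta> + h)"
    by (simp add: integral_nu exp_shift)
  also have "\<dots> = exp (b (\<theta> + h) - b \<theta>)"
    unfolding Z_eq_exp[OF assms(2)] by (simp flip: exp_add)
  finally show "(\<integral>x. exp (x * h) \<partial>ef_nu \<rho> \<theta>) = exp (b (\<theta> + h) - b \<theta>)" .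
qed

lemma nu_prob_space:
  assumes t: "\<theta> \<in> \<Theta>"
  shows "prob_space (ef_nu \<rho> \<theta>)"
proof
  have "emeasure (ef_nu \<rho> \<theta>) (space (ef_nu \<rho> \<theta>)) = (\<integral>\<^sup>+x. ennreal (exp (x * \<theta> - b \<theta>)) \<partial>\<rho>)"
    by (simp add: ef_nu_def emeasure_density)
  also have "\<dots> = ennreal (\<integral>x. exp (x * \<theta> - b \<theta>) \<partial>\<rho>)"
    using exp_integrable[OF t] by (intro nn_integral_eq_integral) (auto simp: exp_diff)
  also have "(\<integral>x. exp (x * \<theta> - b \<theta>) \<partial>\<rho>) = 1"
    using Z_eq_exp[OF t] by (simp add: exp_diff)
  finally show "emeasure (ef_nu \<rho> \<theta>) (space (ef_nu \<rho> \<theta>)) = 1" by simp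
qed

lemma nu_mean:
  assumes t: "\<theta> \<in> \<Theta>"
  shows "integrable (ef_nu \<rho> \<theta>) (\<lambda>x. x)"
    and "(\<integral>x. x \<partial>ef_nu \<rho> \<theta>) = deriv b \<theta>"
proof -
  have e: "exp (x * \<theta> - b \<theta>) * x = (x * exp (x * \<theta>)) / Z \<theta>" for x
    using Z_eq_exp[OF t] by (simp add: exp_diff)
  show "integrable (ef_nu \<rho> \<theta>) (\<lambda>x. x)"
    using Z_derivative(1)[OF t] by (simp add: integral_nu e)
  show "(\<integral>x. x \<partial>ef_nu \<rho> \<theta>) = deriv b \<theta>"
    using DERIV_imp_deriv[OF b_derivative[OF t]] by (simp add: integral_nu e)
qed

text \<open>Convexity of \<open>b\<close>, obtained by integrating \<open>exp y \<ge> 1 + y\<close> against \<open>\<nu>\<^sub>\<theta>\<close>.\<close>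

lemma b_above_tangent:
  assumes t: "\<theta> \<in> \<Theta>" and t': "\<theta>' \<in> \<Theta>"
  shows "b \<theta> + deriv b \<theta> * (\<theta>' - \<theta>) \<le> b \<theta>'"
proof -
  interpret N: prob_space "ef_nu \<rho> \<theta>" using nu_prob_space[OF t] .
  define c where "c = b \<theta>' - b \<theta>"
  note mgf = nu_mgf[OF t, of "\<theta>' - \<theta>"]
  have "1 + (\<theta>' - \<theta>) * deriv b \<theta> - c = (\<integral>x. 1 + x * (\<theta>' - \<theta>) - c \<partial>ef_nu \<rho> \<theta>)"
    using nu_mean[OF t] N.prob_space by simp
  also have "\<dots> \<le> (\<integral>x. exp (- c) * exp (x * (\<theta>' - \<theta>)) \<partial>ef_nu \<rho> \<theta>)"
  proof (rule integral_mono)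
    show "integrable (ef_nu \<rho> \<theta>) (\<lambda>x. 1 + x * (\<theta>' - \<theta>) - c)" using nu_mean[OF t] by simp
    show "integrable (ef_nu \<rho> \<theta>) (\<lambda>x. exp (- c) * exp (x * (\<theta>' - \<theta>)))" using mgf t' by simp
    fix x show "1 + x * (\<theta>' - \<theta>) - c \<le> exp (- c) * exp (x * (\<theta>' - \<theta>))"
      unfolding exp_add[symmetric] using exp_ge_add_one_self[of "- c + x * (\<theta>' - \<theta>)"] by linarith
  qed
  also have "\<dots> = 1" using mgf t' by (simp add: c_def exp_diff)
  finally show ?thesis by (simp add: c_def mult.commute)
qed

text \<open>The tangent inequalities at the two points add up to monotonicity; strictness is the
  injectivity of the mean map.\<close>

lemma deriv_b_strict_mono: "strict_mono_on \<Theta> (deriv b)"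
proof (rule strict_mono_onI)
  fix s t assume st: "s \<in> \<Theta>" "t \<in> \<Theta>" "s < t"
  have "deriv b s * (t - s) \<le> deriv b t * (t - s)"
    using b_above_tangent[OF st(1,2)] b_above_tangent[OF st(2,1)] by (simp add: algebra_simps)
  then have "deriv b s \<le> deriv b t" using st by simp
  moreover have "deriv b s \<noteq> deriv b t" using inj_deriv st by (metis inj_onD less_irrefl)
  ultimately show "deriv b s < deriv b t" by simp
qed

section \<open>The inverse of the mean map and the divergence in mean coordinates\<close>

abbreviation "param \<equiv> ef_param \<rho> \<Theta>"

lemma param:
  assumes "m \<in> M"
  shows "param m \<in> \<Theta>" and "deriv b (param m) = m"
proof -
  have "\<exists>!t. t \<in> \<Theta> \<and> deriv b t = m"
    using assms inj_deriv deriv_image by (auto simp: inj_on_def)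
  then have "param m \<in> \<Theta> \<and> deriv b (param m) = m"
    unfolding ef_param_def by (rule theI')
  then show "param m \<in> \<Theta>" "deriv b (param m) = m" by auto
qed

lemma param_deriv: "t \<in> \<Theta> \<Longrightarrow> param (deriv b t) = t"
  using param[of "deriv b t"] deriv_image inj_deriv by (metis image_eqI inj_onD)

lemma param_strict_mono: "strict_mono_on M param"
proof (rule strict_mono_onI)
  fix m p assume mp: "m \<in> M" "p \<in> M" "m < p"
  show "param m < param p"
  proof (rule ccontr)
    assume "\<not> param m < param p"
    then have "deriv b (param p) \<le> deriv b (param m)"
      using strict_mono_on_leD[OF deriv_b_strict_mono, of "param p" "param m"] param(1) mp by simp
    then show False using param(2)[OF mp(1)] param(2)[OF mp(2)] mp(3) by simp
  qed
qed

text \<open>A monotone function with open image cannot jump.\<close>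

lemma param_continuous: "continuous_on M param"
proof (rule continuous_onI_mono)
  have "param ` M = \<Theta>" using param param_deriv deriv_image by force
  then show "open (param ` M)" using fam by (simp add: canonical_expfam_def)
  show "param x \<le> param y" if "x \<in> M" "y \<in> M" "x \<le> y" for x y
    using strict_mono_on_leD[OF param_strict_mono] that by blast
qed

lemma b_param_continuous: "continuous_on M (\<lambda>m. b (param m))"
proof (rule continuous_on_compose2[OF _ param_continuous])
  show "continuous_on \<Theta> b"
    using b_deriv by (intro continuous_at_imp_continuous_on ballI) (blast intro: DERIV_isCont)
  show "param ` M \<subseteq> \<Theta>" using param by blast
qed

text \<open>The log-density ratio of two members is affine in the observation, so its expectation
  depends on the first member only through the mean \<open>a\<close>.\<close>

lemma ef_kl_eq:
  assumes a: "a \<in> M" and m: "m \<in> M"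
  shows "ef_kl \<rho> \<Theta> a m = b (param m) - b (param a) - a * (param m - param a)"
proof -
  define t s where "t = param a" and "s = param m"
  have t: "t \<in> \<Theta>" "deriv b t = a" and s: "s \<in> \<Theta>" using param a m by (auto simp: t_def s_def)
  interpret S: prob_space "ef_nu \<rho> s" using nu_prob_space[OF s] .
  interpret T: prob_space "ef_nu \<rho> t" using nu_prob_space[OF t(1)] .
  define f where "f x = exp (x * (t - s) - (b t - b s))" for x :: real
  have [measurable]: "f \<in> borel_measurable borel" unfolding f_def[abs_def] by measurable
  have dens: "ef_nu \<rho> t = density (ef_nu \<rho> s) f"
    unfolding ef_nu_def
    by (subst density_density_eq) (auto simp: f_def algebra_simps simp flip: ennreal_mult exp_add intro!: density_cong)
  have "ef_kl \<rho> \<Theta> a m = KL_divergence (exp 1) (ef_nu \<rho> s) (density (ef_nu \<rho> s) f)"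
    unfolding dens[symmetric] by (simp add: ef_kl_def ef_member_def t_def s_def)
  also have "\<dots> = (\<integral>x. f x * log (exp 1) (f x) \<partial>ef_nu \<rho> s)"
    by (intro S.KL_density) (auto simp: f_def)
  also have "\<dots> = (\<integral>x. log (exp 1) (f x) \<partial>density (ef_nu \<rho> s) f)"
    by (subst integral_density) (auto simp: f_def)
  also have "\<dots> = (\<integral>x. x * (t - s) - (b t - b s) \<partial>ef_nu \<rho> t)"
    unfolding dens[symmetric] by (simp add: f_def log_def)
  also have "\<dots> = a * (t - s) - (b t - b s)"
    using nu_mean[OF t(1)] T.prob_space t(2) by simp
  finally show ?thesis by (simp add: t_def s_def algebra_simps)
qed

sublocale bregman_divergence M param "\<lambda>m. b (param m)" "ef_kl \<rho> \<Theta>"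
proof
  show "open M" "is_interval M" using fam by (simp_all add: canonical_expfam_def)
  show "0 \<le> ef_kl \<rho> \<Theta> a m" if "a \<in> M" "m \<in> M" for a m
    using b_above_tangent[of "param a" "param m"] param that by (simp add: ef_kl_eq)
qed (use param_strict_mono param_continuous b_param_continuous ef_kl_eq in auto)

lemma member_prob_space: "m \<in> M \<Longrightarrow> prob_space (ef_member \<rho> \<Theta> m)"
  using nu_prob_space param by (simp add: ef_member_def)

lemma sets_member [simp, measurable_cong]: "sets (ef_member \<rho> \<Theta> m) = sets borel"
  by (simp add: ef_member_def)

text \<open>The exponential tilt that makes the Chernoff bound contract: \<open>b\<close> has slope \<open>m\<close> at the
  parameter of \<open>m\<close>, so a small tilt costs less than any steeper line.\<close>

lemma chernoff_tilt:
  assumes m: "m \<in> M" and e: "0 < e" and sg: "\<sigma> = 1 \<or> \<sigma> = (- 1 :: real)"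
  obtains h c where "0 < h" "c < 1" "0 \<le> c"
    "integrable (ef_member \<rho> \<Theta> m) (\<lambda>x. exp (h * (\<sigma> * (x - m) - e)))"
    "(\<integral>x. exp (h * (\<sigma> * (x - m) - e)) \<partial>ef_member \<rho> \<Theta> m) = c"
proof -
  define t where "t = param m"
  have t: "t \<in> \<Theta>" "deriv b t = m" using param m by (auto simp: t_def)
  \<comment> \<open>The logarithm of the tilted integral. It vanishes at 0 with slope
    \<open>- e\<close>, whichever tail \<sigma> selects.\<close>
  define g where "g h = b (t + \<sigma> * h) - b t - h * (\<sigma> * m + e)" for h
  have "((\<lambda>h. b (t + \<sigma> * h)) has_real_derivative deriv b (t + \<sigma> * 0) * \<sigma>) (at 0)"
    using b_deriv[of "t + \<sigma> * 0"] t(1)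
    by (intro DERIV_chain2[where f = b]) (auto intro!: derivative_eq_intros)
  then have "((\<lambda>h. b (t + \<sigma> * h)) has_real_derivative m * \<sigma>) (at 0)" using t by simp
  then have "(g has_real_derivative - e) (at 0)"
    unfolding g_def[abs_def] by (auto intro!: derivative_eq_intros)
  then obtain q where q: "0 < q" "\<And>h. 0 < h \<Longrightarrow> h < q \<Longrightarrow> g h < g 0"
    using DERIV_neg_dec_right[of g "- e" 0] e by auto
  obtain r where r: "0 < r" "\<forall>h. \<bar>h\<bar> \<le> r \<longrightarrow> t + h \<in> \<Theta>" by (rule Theta_ball[OF t(1)])
  define h where "h = min (q / 2) r"
  have h: "0 < h" "g h < 0" "t + \<sigma> * h \<in> \<Theta>"
    using q r(1) sg q(2)[of h] r(2)[rule_format, of "\<sigma> * h"] by (auto simp: h_def g_def)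
  note mgf = nu_mgf[OF t(1) h(3)]
  have eq: "exp (h * (\<sigma> * (x - m) - e)) = exp (- (h * (\<sigma> * m + e))) * exp (x * (\<sigma> * h))" for x
    by (simp add: algebra_simps flip: exp_add)
  have "integrable (ef_member \<rho> \<Theta> m) (\<lambda>x. exp (h * (\<sigma> * (x - m) - e)))"
    unfolding eq ef_member_def using mgf by (simp add: t_def)
  moreover have "(\<integral>x. exp (h * (\<sigma> * (x - m) - e)) \<partial>ef_member \<rho> \<Theta> m) = exp (g h)"
  proof -
    have "(\<integral>x. exp (h * (\<sigma> * (x - m) - e)) \<partial>ef_member \<rho> \<Theta> m)
        = exp (- (h * (\<sigma> * m + e))) * exp (b (t + \<sigma> * h) - b t)"
      unfolding eq ef_member_def using mgf by (simp flip: t_def)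
    also have "\<dots> = exp (g h)" unfolding exp_add[symmetric] by (simp add: g_def)
    finally show ?thesis .
  qed
  ultimately show ?thesis using that[of h "exp (g h)"] h by simp
qed

end

section \<open>Deviations of the empirical means\<close>

lemma emeasure_le_nn_integral:
  assumes "A \<in> sets M" "\<And>x. x \<in> A \<Longrightarrow> 1 \<le> f x"
  shows "emeasure M A \<le> (\<integral>\<^sup>+x. f x \<partial>M)"
proof -
  have "emeasure M A = (\<integral>\<^sup>+x. indicator A x \<partial>M)" using assms by simp
  also have "\<dots> \<le> (\<integral>\<^sup>+x. f x \<partial>M)"
    using assms by (intro nn_integral_mono) (auto simp: indicator_def)
  finally show ?thesis .
qed

locale bandit = expfam +
  fixes n :: nat and \<mu> :: "nat \<Rightarrow> real"
  assumes two_arms: "2 \<le> n" and means: "i < n \<Longrightarrow> \<mu> i \<in> M"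
begin

abbreviation "\<S> \<equiv> sample_space \<rho> \<Theta> n \<mu>"

sublocale S: prob_space \<S>
  unfolding sample_space_def using means by (intro prob_space_PiM member_prob_space) auto

lemma sample_measurable [measurable]: "i < n \<Longrightarrow> (\<lambda>X. X (i, j)) \<in> borel_measurable \<S>"
proof -
  assume "i < n"
  then have "(\<lambda>X. X (i, j)) \<in> \<S> \<rightarrow>\<^sub>M ef_member \<rho> \<Theta> (\<mu> (fst (i, j)))"
    unfolding sample_space_def by (intro measurable_component_singleton) auto
  then show ?thesis by (simp cong: measurable_cong_sets)
qed

text \<open>Independence enters here: the first \<open>s\<close> samples of an arm are a reindexed
  subfamily of the product space, and their law is again a product.\<close>

lemma nn_integral_prod_samples:
  assumes i: "i < n" and [measurable]: "g \<in> borel_measurable borel"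
  shows "(\<integral>\<^sup>+X. (\<Prod>j<s. g (X (i, j))) \<partial>\<S>) = (\<integral>\<^sup>+x. g x \<partial>ef_member \<rho> \<Theta> (\<mu> i)) ^ s"
proof -
  let ?N = "ef_member \<rho> \<Theta> (\<mu> i)"
  interpret N: prob_space ?N using member_prob_space means i by simp
  interpret P: product_sigma_finite "\<lambda>_::nat. ?N" by standard
  have "(\<integral>\<^sup>+x. g x \<partial>?N) ^ s = (\<integral>\<^sup>+y. (\<Prod>j<s. g (y j)) \<partial>(\<Pi>\<^sub>M j\<in>{..<s}. ?N))"
    by (subst P.product_nn_integral_prod) (auto cong: measurable_cong_sets)
  also have "(\<Pi>\<^sub>M j\<in>{..<s}. ?N)
      = distr \<S> (\<Pi>\<^sub>M j\<in>{..<s}. ?N) (\<lambda>X. \<lambda>j\<in>{..<s}. X (i, j))"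
    using distr_PiM_reindex[of "{..<n} \<times> UNIV" "\<lambda>p. ef_member \<rho> \<Theta> (\<mu> (fst p))"
        "\<lambda>j::nat. (i, j)" "{..<s}"] member_prob_space means i
    by (auto simp: sample_space_def inj_on_def)
  also have "(\<integral>\<^sup>+y. (\<Prod>j<s. g (y j)) \<partial>\<dots>) = (\<integral>\<^sup>+X. (\<Prod>j<s. g ((\<lambda>j\<in>{..<s}. X (i, j)) j)) \<partial>\<S>)"
  proof (rule nn_integral_distr)
    show "(\<lambda>X. \<lambda>j\<in>{..<s}. X (i, j)) \<in> \<S> \<rightarrow>\<^sub>M Pi\<^sub>M {..<s} (\<lambda>j. ?N)"
      using i by (intro measurable_restrict) (simp cong: measurable_cong_sets)
    have "(\<lambda>y. g (y j)) \<in> borel_measurable (Pi\<^sub>M {..<s} (\<lambda>j. ?N))" if "j \<in> {..<s}" for j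
      using that by (intro measurable_compose[OF measurable_component_singleton[of j]])
        (auto cong: measurable_cong_sets)
    then have "(\<lambda>y. \<Prod>j<s. g (y j)) \<in> borel_measurable (Pi\<^sub>M {..<s} (\<lambda>j. ?N))"
      by (intro borel_measurable_prod_ennreal)
    then show "(\<lambda>y. \<Prod>j<s. g (y j))
        \<in> borel_measurable (distr \<S> (\<Pi>\<^sub>M j\<in>{..<s}. ?N) (\<lambda>X. \<lambda>j\<in>{..<s}. X (i, j)))"
      by simp
  qed
  finally show ?thesis by simp
qed

text \<open>Markov's inequality for a product of tilted samples, each contributing the factor
  \<open>c\<close> from \<open>chernoff_tilt\<close>.\<close>

lemma one_sided_deviation:
  assumes i: "i < n" and e: "0 < e" and sg: "\<sigma> = 1 \<or> \<sigma> = (- 1 :: real)"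
  obtains c where "0 \<le> c" "c < 1"
    "\<forall>s. measure \<S> {X \<in> space \<S>. e * real s \<le> (\<Sum>j<s. \<sigma> * (X (i, j) - \<mu> i))} \<le> c ^ s"
proof -
  let ?N = "ef_member \<rho> \<Theta> (\<mu> i)"
  obtain h c where hc: "0 < h" "c < 1" "0 \<le> c"
    "integrable ?N (\<lambda>x. exp (h * (\<sigma> * (x - \<mu> i) - e)))"
    "(\<integral>x. exp (h * (\<sigma> * (x - \<mu> i) - e)) \<partial>?N) = c"
    using chernoff_tilt[OF means[OF i] e sg] by blast
  define g where "g x = ennreal (exp (h * (\<sigma> * (x - \<mu> i) - e)))" for x
  have [measurable]: "g \<in> borel_measurable borel" unfolding g_def[abs_def] by measurable
  have gc: "(\<integral>\<^sup>+x. g x \<partial>?N) = ennreal c"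
    unfolding g_def using hc by (subst nn_integral_eq_integral) auto
  have "measure \<S> {X \<in> space \<S>. e * real s \<le> (\<Sum>j<s. \<sigma> * (X (i, j) - \<mu> i))} \<le> c ^ s" for s
  proof -
    let ?A = "{X \<in> space \<S>. e * real s \<le> (\<Sum>j<s. \<sigma> * (X (i, j) - \<mu> i))}"
    have A: "?A \<in> sets \<S>" using i by measurable
    have "emeasure \<S> ?A \<le> (\<integral>\<^sup>+X. (\<Prod>j<s. g (X (i, j))) \<partial>\<S>)"
    proof (rule emeasure_le_nn_integral[OF A])
      fix X assume "X \<in> ?A"
      then have "0 \<le> h * ((\<Sum>j<s. \<sigma> * (X (i, j) - \<mu> i)) - e * real s)" using hc by simp
      also have "\<dots> = (\<Sum>j<s. h * (\<sigma> * (X (i, j) - \<mu> i) - e))"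
        by (simp add: sum_subtractf algebra_simps flip: sum_distrib_left)
      finally have "1 \<le> exp (\<Sum>j<s. h * (\<sigma> * (X (i, j) - \<mu> i) - e))" by simp
      then have "1 \<le> ennreal (exp (\<Sum>j<s. h * (\<sigma> * (X (i, j) - \<mu> i) - e)))" by simp
      also have "\<dots> = (\<Prod>j<s. g (X (i, j)))" by (simp add: g_def exp_sum prod_ennreal)
      finally show "1 \<le> (\<Prod>j<s. g (X (i, j)))" .
    qed
    also have "\<dots> = ennreal (c ^ s)"
      using nn_integral_prod_samples[OF i, of g s] gc hc by (simp add: ennreal_power)
    finally show ?thesis using hc by (simp add: S.emeasure_eq_measure)
  qed
  then show ?thesis using that hc by blast
qed

text \<open>Quantifying over all sample sizes from \<open>s0\<close> on covers the data-dependent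
  pull counts, so no stopping-time argument has to follow.\<close>

definition deviation_event :: "real \<Rightarrow> nat \<Rightarrow> (nat \<times> nat \<Rightarrow> real) set" where
  "deviation_event e s0 = {X \<in> space \<S>. \<exists>i<n. \<exists>s\<ge>s0. e \<le> \<bar>(\<Sum>j<s. X (i, j)) / real s - \<mu> i\<bar>}"

lemma deviation_event_measurable [measurable]: "deviation_event e s0 \<in> sets \<S>"
proof -
  have "deviation_event e s0 = (\<Union>i\<in>{..<n}. \<Union>s\<in>{s0..}.
      {X \<in> space \<S>. e \<le> \<bar>(\<Sum>j<s. X (i, j)) / real s - \<mu> i\<bar>})"
    by (auto simp: deviation_event_def)
  also have "\<dots> \<in> sets \<S>" by measurable
  finally show ?thesis .
qed

text \<open>A union bound over arms, both tails and all sample sizes; the geometric series over the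
  sizes preserves the rate \<open>c ^ s0\<close>.\<close>

lemma deviation_bound:
  assumes e: "0 < e"
  obtains K c where "0 < c" "c < 1" "0 \<le> K"
    "\<forall>s0\<ge>1. measure \<S> (deviation_event e s0) \<le> K * c ^ s0"
proof -
  define I where "I = {..<n} \<times> {1, - 1 :: real}"
  define A where "A p s = {X \<in> space \<S>. e * real s \<le> (\<Sum>j<s. snd p * (X (fst p, j) - \<mu> (fst p)))}"
    for p :: "nat \<times> real" and s
  have finI: "finite I" by (simp add: I_def)
  have "\<forall>p\<in>I. \<exists>c. 0 \<le> c \<and> c < 1 \<and> (\<forall>s. measure \<S> (A p s) \<le> c ^ s)"
  proof
    fix p assume "p \<in> I"
    then have p: "fst p < n" "snd p = 1 \<or> snd p = - 1" by (auto simp: I_def)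
    obtain c where "0 \<le> c" "c < 1"
      "\<forall>s. measure \<S> {X \<in> space \<S>. e * real s \<le> (\<Sum>j<s. snd p * (X (fst p, j) - \<mu> (fst p)))} \<le> c ^ s"
      by (rule one_sided_deviation[OF p(1) e p(2)])
    then show "\<exists>c. 0 \<le> c \<and> c < 1 \<and> (\<forall>s. measure \<S> (A p s) \<le> c ^ s)"
      unfolding A_def by blast
  qed
  then obtain C where C: "\<forall>p\<in>I. 0 \<le> C p \<and> C p < 1 \<and> (\<forall>s. measure \<S> (A p s) \<le> C p ^ s)"
    by (rule bchoice[THEN exE])
  \<comment> \<open>The 1/2 keeps \<open>c\<close> positive even if all \<open>C p\<close> vanish;
    the logarithm of \<open>c\<close> is taken later.\<close>
  define c where "c = Max (insert (1/2) (C ` I))"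
  have c: "0 < c" "c < 1"
    unfolding c_def using finI C by (auto simp: Max_gr_iff)
  have A_bound: "measure \<S> (A p s) \<le> c ^ s" if "p \<in> I" for p s
  proof -
    have "C p \<le> c" unfolding c_def using finI that by (intro Max_ge) auto
    then have "C p ^ s \<le> c ^ s" using C that by (intro power_mono) auto
    then show ?thesis using C that by (meson order_trans)
  qed
  have A_sets: "A p s \<in> sets \<S>" if "p \<in> I" for p s
    unfolding A_def using that by (auto simp: I_def)
  define K where "K = real (card I) / (1 - c)"
  have "measure \<S> (deviation_event e s0) \<le> K * c ^ s0" if s0: "1 \<le> s0" for s0
  proof -
    define U where "U m = (\<Union>p\<in>I. A p (s0 + m))" for m
    have U_sets: "U m \<in> sets \<S>" for m unfolding U_def using A_sets finI by auto
    have U_le: "measure \<S> (U m) \<le> real (card I) * c ^ s0 * c ^ m" for m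
    proof -
      have "measure \<S> (U m) \<le> (\<Sum>p\<in>I. measure \<S> (A p (s0 + m)))"
        unfolding U_def using A_sets finI by (intro S.finite_measure_subadditive_finite) auto
      also have "\<dots> \<le> (\<Sum>p\<in>I. c ^ (s0 + m))" by (intro sum_mono A_bound)
      finally show ?thesis by (simp add: power_add mult.assoc)
    qed
    have geo: "(\<lambda>m. real (card I) * c ^ s0 * c ^ m) sums (real (card I) * c ^ s0 * (1 / (1 - c)))"
      using c by (intro sums_mult geometric_sums) auto
    have summ: "summable (\<lambda>m. measure \<S> (U m))"
      by (rule summable_comparison_test'[OF sums_summable[OF geo], of 0]) (use U_le in auto)
    have "deviation_event e s0 \<subseteq> (\<Union>m. U m)"
    proof
      fix X assume "X \<in> deviation_event e s0"
      then obtain i s where X: "X \<in> space \<S>" "i < n" "s0 \<le> s"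
        "e \<le> \<bar>(\<Sum>j<s. X (i, j)) / real s - \<mu> i\<bar>" by (auto simp: deviation_event_def)
      define D where "D = (\<Sum>j<s. X (i, j)) / real s - \<mu> i"
      have s: "0 < real s" using s0 X by simp
      have sD: "(\<Sum>j<s. \<sigma> * (X (i, j) - \<mu> i)) = \<sigma> * D * real s" for \<sigma>
        using s by (simp add: D_def sum_subtractf field_simps flip: sum_distrib_left)
      obtain \<sigma> where sg: "\<sigma> \<in> {1, - 1 :: real}" "\<bar>D\<bar> = \<sigma> * D"
        using that[of 1] that[of "- 1"] by (cases "0 \<le> D") auto
      have "e * real s \<le> \<sigma> * D * real s" using X(4) sg s by (simp add: D_def)
      then have "X \<in> A (i, \<sigma>) s" using X by (simp add: A_def sD)
      then have "X \<in> U (s - s0)" using X sg by (auto simp: U_def I_def)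
      then show "X \<in> (\<Union>m. U m)" by blast
    qed
    then have "measure \<S> (deviation_event e s0) \<le> measure \<S> (\<Union>m. U m)"
      using U_sets by (intro S.finite_measure_mono) auto
    also have "\<dots> \<le> (\<Sum>m. measure \<S> (U m))"
      using U_sets summ by (intro S.finite_measure_subadditive_countably) auto
    also have "\<dots> \<le> (\<Sum>m. real (card I) * c ^ s0 * c ^ m)"
      using U_le summ geo by (intro suminf_le) (auto simp: sums_iff)
    also have "\<dots> = K * c ^ s0" using geo by (simp add: sums_iff K_def)
    finally show ?thesis .
  qed
  moreover have "0 \<le> K" using c by (simp add: K_def)
  ultimately show ?thesis using that c by blast
qed

end

section \<open>Measurability of the batch complexity\<close>

context expfam
begin

text \<open>With respect to the probability measure of any member, \<rho> has the finite density
  \<open>exp (b t - x * t)\<close>. This gives measurability of parametrised integrals against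
  \<rho>.\<close>

lemma sigma_finite_rho: "sigma_finite_measure \<rho>"
proof -
  obtain t where t: "t \<in> \<Theta>" using fam by (auto simp: canonical_expfam_def)
  interpret N: prob_space "ef_nu \<rho> t" using nu_prob_space[OF t] .
  define f where "f x = ennreal (exp (b t - x * t))" for x
  have [measurable]: "f \<in> borel_measurable borel" unfolding f_def[abs_def] by measurable
  have "density (ef_nu \<rho> t) f = density \<rho> (\<lambda>x. ennreal (exp (x * t - b t)) * f x)"
    unfolding ef_nu_def by (subst density_density_eq) auto
  also have "(\<lambda>x. ennreal (exp (x * t - b t)) * f x) = (\<lambda>x. 1)"
    by (auto simp: f_def simp flip: ennreal_mult exp_add)
  also have "density \<rho> (\<lambda>x. 1) = \<rho>" by (rule density_1)
  finally have "density (ef_nu \<rho> t) f = \<rho>" .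
  moreover have "sigma_finite_measure (density (ef_nu \<rho> t) f)"
    by (subst N.sigma_finite_iff_density_finite) (auto simp: f_def)
  ultimately show ?thesis by simp
qed

lemma b_measurable [measurable]: "b \<in> borel_measurable borel"
proof -
  interpret sigma_finite_measure \<rho> by (rule sigma_finite_rho)
  show ?thesis unfolding ef_b_def[abs_def] by measurable
qed

lemma param_measurable [measurable]: "param \<in> borel_measurable borel"
proof -
  have "param m = (if m \<in> M then param m else (THE t. False))" for m
  proof (cases "m \<in> M")
    case False
    then have "(\<lambda>t. t \<in> \<Theta> \<and> deriv b t = m) = (\<lambda>t. False)" using deriv_image by auto
    then show ?thesis using False by (simp add: ef_param_def)
  qed simp
  then have "param = (\<lambda>m. if m \<in> M then param m else (THE t. False))" by blast
  moreover have "(\<lambda>m. if m \<in> M then param m else (THE t. False)) \<in> borel_measurable borel"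
    using M_open by (intro borel_measurable_continuous_on_if param_continuous continuous_on_const) auto
  ultimately show ?thesis by simp
qed

text \<open>The algorithm also evaluates the divergence at empirical means outside of \<open>M\<close>, where
  \<open>ef_param\<close> is a junk constant; the integral representation is valid there as well.\<close>

lemma ef_kl_measurable [measurable (raw)]:
  assumes [measurable]: "f \<in> borel_measurable N" "g \<in> borel_measurable N"
  shows "(\<lambda>x. ef_kl \<rho> \<Theta> (f x) (g x)) \<in> borel_measurable N"
proof -
  interpret sigma_finite_measure \<rho> by (rule sigma_finite_rho)
  define p where "p a x = exp (x * param a - b (param a))" for a x :: real
  have [measurable]: "(\<lambda>(a, x). p a x) \<in> borel_measurable (borel \<Otimes>\<^sub>M borel)"
    unfolding p_def by measurable
  have "ef_kl \<rho> \<Theta> a m = (\<integral>x. p a x * log (exp 1) (p a x / p m x) \<partial>\<rho>)" for a m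
    unfolding ef_kl_def ef_member_def ef_nu_def p_def by (rule KL_density_density) auto
  then show ?thesis unfolding p_def by simp
qed

lemma valid_instance_sets: "{lam. valid_instance M n k lam} \<in> sets borel"
proof -
  have [measurable]: "M \<in> sets borel" using M_open by simp
  have "Measurable.pred borel (\<lambda>lam :: nat \<Rightarrow> real. valid_instance M n k lam)"
    unfolding valid_instance_def by measurable
  then show ?thesis by (simp add: pred_def)
qed

lemma continuous_on_valid:
  assumes "2 \<le> n"
  shows "continuous_on {lam. valid_instance M n k lam} (\<lambda>lam. wstar (ef_kl \<rho> \<Theta>) M n k lam i)"
    and "continuous_on {lam. valid_instance M n k lam} (\<lambda>lam. Tstar_inv (ef_kl \<rho> \<Theta>) M n k lam)"
proof -
  have coord: "(\<lambda>s. x s i) \<longlonglongrightarrow> a i" if "x \<longlonglongrightarrow> a" for x :: "nat \<Rightarrow> nat \<Rightarrow> real" and a i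
  proof -
    have "isCont (\<lambda>x::nat \<Rightarrow> real. x i) a"
      using continuous_on_product_coordinates[of i] continuous_on_eq_continuous_at[OF open_UNIV] by blast
    from isCont_tendsto_compose[OF this that] show ?thesis .
  qed
  show "continuous_on {lam. valid_instance M n k lam} (\<lambda>lam. wstar (ef_kl \<rho> \<Theta>) M n k lam i)"
    unfolding continuous_on_sequentially comp_def
  proof (intro allI ballI impI)
    fix x a assume "a \<in> {lam. valid_instance M n k lam}"
      "(\<forall>s. x s \<in> {lam. valid_instance M n k lam}) \<and> x \<longlonglongrightarrow> a"
    then show "(\<lambda>s. wstar (ef_kl \<rho> \<Theta>) M n k (x s) i) \<longlonglongrightarrow> wstar (ef_kl \<rho> \<Theta>) M n k a i"
      by (intro wstar_and_Tstar_inv_continuous(1)[OF _ assms] coord) auto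
  qed
  show "continuous_on {lam. valid_instance M n k lam} (\<lambda>lam. Tstar_inv (ef_kl \<rho> \<Theta>) M n k lam)"
    unfolding continuous_on_sequentially comp_def
  proof (intro allI ballI impI)
    fix x a assume "a \<in> {lam. valid_instance M n k lam}"
      "(\<forall>s. x s \<in> {lam. valid_instance M n k lam}) \<and> x \<longlonglongrightarrow> a"
    then show "(\<lambda>s. Tstar_inv (ef_kl \<rho> \<Theta>) M n k (x s)) \<longlonglongrightarrow> Tstar_inv (ef_kl \<rho> \<Theta>) M n k a"
      by (intro wstar_and_Tstar_inv_continuous(2)[OF _ assms] coord) auto
  qed
qed

text \<open>A choice operator has no measurability of its own. Here it picks the only maximiser,
  which is continuous on valid instances, and the convention for all others is a constant.\<close>

lemma wstar_measurable [measurable]: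
  assumes "2 \<le> n"
  shows "(\<lambda>lam. wstar (ef_kl \<rho> \<Theta>) M n k lam i) \<in> borel_measurable borel"
proof -
  have "(\<lambda>lam. if lam \<in> {lam. valid_instance M n k lam} then wstar (ef_kl \<rho> \<Theta>) M n k lam i
      else uniform_w n i) \<in> borel_measurable borel"
    by (intro borel_measurable_continuous_on_if valid_instance_sets continuous_on_valid assms
        continuous_on_const)
  moreover have "(\<lambda>lam. if lam \<in> {lam. valid_instance M n k lam}
      then wstar (ef_kl \<rho> \<Theta>) M n k lam i else uniform_w n i)
    = (\<lambda>lam. wstar (ef_kl \<rho> \<Theta>) M n k lam i)"
    by (auto simp: wstar_def)
  ultimately show ?thesis by simp
qed

lemma Tstar_measurable [measurable]:
  assumes "2 \<le> n"
  shows "(\<lambda>lam. Tstar (ef_kl \<rho> \<Theta>) M n k lam) \<in> borel_measurable borel"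
proof -
  \<comment> \<open>The 0 is an arbitrary filler: on invalid instances nothing is known about
    \<open>Tstar_inv\<close>, and the outer case distinction discards it.\<close>
  have [measurable]: "(\<lambda>lam. if lam \<in> {lam. valid_instance M n k lam} then Tstar_inv (ef_kl \<rho> \<Theta>) M n k lam
      else 0) \<in> borel_measurable borel"
    by (intro borel_measurable_continuous_on_if valid_instance_sets continuous_on_valid assms
        continuous_on_const)
  have [measurable]: "{lam. valid_instance M n k lam} \<in> sets borel" by (rule valid_instance_sets)
  have "(\<lambda>lam. if lam \<in> {lam. valid_instance M n k lam}
      then ereal (1 / (if lam \<in> {lam. valid_instance M n k lam} then Tstar_inv (ef_kl \<rho> \<Theta>) M n k lam else 0))
      else \<infinity>) \<in> borel_measurable borel"
    by measurable
  moreover have "(\<lambda>lam. if lam \<in> {lam. valid_instance M n k lam}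
      then ereal (1 / (if lam \<in> {lam. valid_instance M n k lam} then Tstar_inv (ef_kl \<rho> \<Theta>) M n k lam else 0))
      else \<infinity>) = (\<lambda>lam. Tstar (ef_kl \<rho> \<Theta>) M n k lam)"
    by (auto simp: Tstar_def)
  ultimately show ?thesis by simp
qed

end

lemma measurable_count_space_binary:
  fixes f :: "'a \<Rightarrow> 'b :: countable" and g :: "'a \<Rightarrow> 'c :: countable"
  assumes f: "f \<in> N \<rightarrow>\<^sub>M count_space UNIV" and g: "g \<in> N \<rightarrow>\<^sub>M count_space UNIV"
  shows "(\<lambda>x. h (f x) (g x)) \<in> N \<rightarrow>\<^sub>M count_space UNIV"
  by (rule measurable_compose_countable[OF _ f, where f = "\<lambda>i x. h i (g x)"])
    (rule measurable_compose[OF g], simp)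

section \<open>Measurability along a run\<close>

context bandit
begin

text \<open>The sample size is random; splitting over its countably many values leaves averages of
  fixed length. Indices from \<open>n\<close> on are not coordinates of the sample space, and a zero
  count makes their mean the constant 0.\<close>

lemma emp_mean_measurable:
  assumes [measurable]: "\<And>i. (\<lambda>X. N X i) \<in> \<S> \<rightarrow>\<^sub>M count_space UNIV"
    and zero: "\<And>X i. n \<le> i \<Longrightarrow> N X i = 0"
  shows "(\<lambda>X. emp_mean X (N X) i) \<in> borel_measurable \<S>"
proof (cases "i < n")
  case True
  then have "(\<lambda>X. (\<Sum>j<m. X (i, j)) / real m) \<in> borel_measurable \<S>" for m by measurable
  then show ?thesis
    unfolding emp_mean_def
    by (rule measurable_compose_countable[where f = "\<lambda>m X. (\<Sum>j<m. X (i, j)) / real m"]) measurable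
next
  case False
  then show ?thesis using zero by (simp add: emp_mean_def)
qed

declare sample_measurable [measurable del]

lemma emp_best_measurable:
  assumes [measurable]: "\<And>i. (\<lambda>X. m X i) \<in> borel_measurable N"
  shows "(\<lambda>X. emp_best n (m X)) \<in> N \<rightarrow>\<^sub>M count_space UNIV"
  unfolding emp_best_def by measurable

lemma stage2_zero: "n \<le> i \<Longrightarrow> fst (stage2 d M n \<delta> \<epsilon> L1 L2 \<alpha> X q) i = 0"
  by (cases q) (auto simp: Let_def split: prod.split)

lemma stage2_measurable:
  fixes \<delta> \<epsilon> L1 L2 \<alpha> :: real
  defines "st \<equiv> \<lambda>q X. stage2 (ef_kl \<rho> \<Theta>) M n \<delta> \<epsilon> L1 L2 \<alpha> X q"
  shows "(\<forall>i. (\<lambda>X. fst (st q X) i) \<in> \<S> \<rightarrow>\<^sub>M count_space UNIV)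
    \<and> (\<forall>i. (\<lambda>X. fst (snd (st q X)) i) \<in> borel_measurable \<S>)
    \<and> (\<forall>i. (\<lambda>X. snd (snd (st q X)) i) \<in> borel_measurable \<S>)"
proof (induction q)
  case 0
  then show ?case by (simp add: st_def)
next
  case (Suc q)
  have [measurable]: "(\<lambda>X. fst (st q X) i) \<in> \<S> \<rightarrow>\<^sub>M count_space UNIV"
    "(\<lambda>X. fst (snd (st q X)) i) \<in> borel_measurable \<S>" for i
    using Suc by auto
  define m where "m X = emp_mean X (fst (st q X))" for X
  have [measurable]: "(\<lambda>X. m X i) \<in> borel_measurable \<S>" for i
    unfolding m_def by (rule emp_mean_measurable) (measurable, simp add: st_def stage2_zero)
  define k where "k X = emp_best n (m X)" for X
  have k[measurable]: "k \<in> \<S> \<rightarrow>\<^sub>M count_space UNIV"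
    unfolding k_def by (intro emp_best_measurable) measurable
  \<comment> \<open>The designated index is random too. It is first frozen as \<open>k0\<close>, and
    its countably many values are recombined afterwards.\<close>
  define bb where "bb k0 X = (\<lambda>i. if i = k0 then m X i - \<epsilon> else m X i + \<epsilon>)" for k0 X
  have [measurable]: "bb k0 \<in> borel_measurable \<S>" for k0
    by (rule measurable_coordinatewise_then_product) (simp add: bb_def)
  define w where "w X = wstar (ef_kl \<rho> \<Theta>) M n (k X) (bb (k X) X)" for X
  have [measurable]: "(\<lambda>X. w X i) \<in> borel_measurable \<S>" for i
    unfolding w_def
    by (rule measurable_compose_countable[OF _ k, where f = "\<lambda>k0 X. wstar (ef_kl \<rho> \<Theta>) M n k0 (bb k0 X) i"])
      (rule measurable_compose[OF _ wstar_measurable[OF two_arms]], measurable)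
  define Ts where "Ts X = Tstar (ef_kl \<rho> \<Theta>) M n (k X) (bb (k X) X)" for X
  have [measurable]: "Ts \<in> borel_measurable \<S>"
    unfolding Ts_def
    by (rule measurable_compose_countable[OF _ k, where f = "\<lambda>k0 X. Tstar (ef_kl \<rho> \<Theta>) M n k0 (bb k0 X)"])
      (rule measurable_compose[OF _ Tstar_measurable[OF two_arms]], measurable)
  define T where "T X i = real_of_ereal (min (ereal \<alpha> * ereal (w X i) * Ts X * ereal (ln (1 / \<delta>))) (ereal L2))"
    for X i
  have [measurable]: "(\<lambda>X. T X i) \<in> borel_measurable \<S>" for i
    unfolding T_def by measurable
  have eq: "st (Suc q) X =
      ((\<lambda>i. if i < n then fst (st q X) i + nat (\<lceil>T X i\<rceil> - \<lceil>fst (snd (st q X)) i\<rceil>) else 0),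
       (\<lambda>i. max (fst (snd (st q X)) i) (T X i)), w X)" for X
    unfolding st_def stage2.simps Let_def w_def Ts_def T_def k_def m_def bb_def
    by (simp add: split_def)
  have ceil: "(\<lambda>X. \<lceil>T X i\<rceil>) \<in> \<S> \<rightarrow>\<^sub>M count_space UNIV"
    "(\<lambda>X. \<lceil>fst (snd (st q X)) i\<rceil>) \<in> \<S> \<rightarrow>\<^sub>M count_space UNIV" for i
    by measurable
  have "(\<lambda>X. fst (st (Suc q) X) i) \<in> \<S> \<rightarrow>\<^sub>M count_space UNIV" for i
  proof (cases "i < n")
    case True
    have "(\<lambda>X. \<lceil>T X i\<rceil> - \<lceil>fst (snd (st q X)) i\<rceil>) \<in> \<S> \<rightarrow>\<^sub>M count_space UNIV"
      using ceil by (rule measurable_count_space_binary)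
    then have "(\<lambda>X. fst (st q X) i + nat (\<lceil>T X i\<rceil> - \<lceil>fst (snd (st q X)) i\<rceil>)) \<in> \<S> \<rightarrow>\<^sub>M count_space UNIV"
      by (rule measurable_count_space_binary[rotated]) measurable
    then show ?thesis using True by (simp add: eq)
  qed (simp add: eq)
  moreover have "(\<lambda>X. fst (snd (st (Suc q) X)) i) \<in> borel_measurable \<S>" for i
    unfolding eq by simp
  moreover have "(\<lambda>X. snd (snd (st (Suc q) X)) i) \<in> borel_measurable \<S>" for i
    unfolding eq by simp
  ultimately show ?case by blast
qed

lemma B_delta_measurable: "B_delta \<rho> \<Theta> M n \<alpha> \<delta> \<in> \<S> \<rightarrow>\<^sub>M count_space UNIV"
proof -
  define \<epsilon> L1 L2 where "\<epsilon> = 1 / ln (ln (1 / \<delta>))" and "L1 = sqrt (ln (1 / \<delta>))"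
    and "L2 = ln (1 / \<delta>) * ln (ln (1 / \<delta>)) / real n"
  define \<beta> where "\<beta> = (\<lambda>t \<delta>' :: real. ln (ln (1 / \<delta>') * t powr \<alpha> / \<delta>'))"
  define st where "st q X = stage2 (ef_kl \<rho> \<Theta>) M n \<delta> \<epsilon> L1 L2 \<alpha> X q" for q X
  have st[measurable]: "(\<lambda>X. fst (st q X) i) \<in> \<S> \<rightarrow>\<^sub>M count_space UNIV"
    "(\<lambda>X. snd (snd (st q X)) i) \<in> borel_measurable \<S>" for q i
    using stage2_measurable[of \<delta> \<epsilon> L1 L2 \<alpha> q] by (auto simp: st_def)
  have [measurable]: "Measurable.pred \<S> (\<lambda>X. stage2_exit (ef_kl \<rho> \<Theta>) M n \<delta> \<epsilon> L1 L2 \<alpha> X q)" for q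
    unfolding stage2_exit_def st_def[symmetric] by measurable
  define it where "it X = stage2_iters (ef_kl \<rho> \<Theta>) M n \<delta> \<epsilon> L1 L2 \<alpha> X" for X
  have it[measurable]: "it \<in> \<S> \<rightarrow>\<^sub>M count_space UNIV"
    unfolding it_def stage2_iters_def Let_def by measurable
  define N where "N X = fst (st (it X) X)" for X
  have [measurable]: "(\<lambda>X. N X i) \<in> \<S> \<rightarrow>\<^sub>M count_space UNIV" for i
    unfolding N_def by (rule measurable_compose_countable[OF _ it, where f = "\<lambda>q X. fst (st q X) i"]) (rule st)
  define m where "m X = emp_mean X (N X)" for X
  have [measurable]: "(\<lambda>X. m X i) \<in> borel_measurable \<S>" for i
    unfolding m_def by (rule emp_mean_measurable) (measurable, simp add: N_def st_def stage2_zero)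
  define k where "k X = emp_best n (m X)" for X
  have k[measurable]: "k \<in> \<S> \<rightarrow>\<^sub>M count_space UNIV"
    unfolding k_def by (intro emp_best_measurable) measurable
  define Q where "Q k0 X \<longleftrightarrow> (\<forall>j<n. j \<noteq> k0 \<longrightarrow>
      Zstat (ef_kl \<rho> \<Theta>) (N X k0) (N X j) (m X k0) (m X j) \<ge> \<beta> (real (\<Sum>i<n. N X i)) (\<delta> / 2))" for k0 X
  have Q: "Measurable.pred \<S> (Q k0)" for k0
  proof -
    have rN[measurable]: "(\<lambda>X. real (N X i)) \<in> borel_measurable \<S>" for i
      by measurable
    have Z[measurable]: "(\<lambda>X. Zstat (ef_kl \<rho> \<Theta>) (N X k0) (N X j) (m X k0) (m X j)) \<in> borel_measurable \<S>" for j
      unfolding Zstat_def Let_def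
      by (intro borel_measurable_add borel_measurable_times borel_measurable_divide ef_kl_measurable) measurable
    have "(\<lambda>X. real (\<Sum>i<n. N X i)) \<in> borel_measurable \<S>"
      unfolding of_nat_sum by (intro borel_measurable_sum rN)
    then have [measurable]: "(\<lambda>X. \<beta> (real (\<Sum>i<n. N X i)) (\<delta> / 2)) \<in> borel_measurable \<S>"
      unfolding \<beta>_def by (rule measurable_compose) measurable
    show ?thesis unfolding Q_def by measurable
  qed
  have "Measurable.pred \<S> (\<lambda>X. Q (k X) X)"
    by (rule measurable_compose_countable[OF _ k, where f = Q]) (rule Q)
  moreover have "stage3_stops (ef_kl \<rho> \<Theta>) M n \<delta> \<epsilon> L1 L2 \<alpha> \<beta> X \<longleftrightarrow> Q (k X) X" for X
    unfolding stage3_stops_def Q_def k_def m_def N_def st_def it_def Let_def by simp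
  ultimately have [measurable]: "Measurable.pred \<S> (\<lambda>X. stage3_stops (ef_kl \<rho> \<Theta>) M n \<delta> \<epsilon> L1 L2 \<alpha> \<beta> X)"
    by simp
  have "B_delta \<rho> \<Theta> M n \<alpha> \<delta> =
      (\<lambda>X. 1 + it X + (if stage3_stops (ef_kl \<rho> \<Theta>) M n \<delta> \<epsilon> L1 L2 \<alpha> \<beta> X then 0 else 1))"
    unfolding B_delta_def tri_bbai_batches_def it_def \<epsilon>_def L1_def L2_def \<beta>_def by (rule ext) simp
  also have "\<dots> \<in> \<S> \<rightarrow>\<^sub>M count_space UNIV" by measurable
  finally show ?thesis .
qed

end

section \<open>Runs with accurate empirical means\<close>

text \<open>Counterexamples at radii \<open>1 / (s + 1)\<close> would form a convergent sequence.
  This turns sequential limits into one radius that constrains only the first \<open>n\<close>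
  coordinates.\<close>

lemma coordinatewise_nbhd:
  fixes a :: "nat \<Rightarrow> real" and n :: nat
  assumes ev: "\<And>f. (\<And>i. i < n \<Longrightarrow> (\<lambda>s. f s i) \<longlonglongrightarrow> a i) \<Longrightarrow> \<forall>\<^sub>F s in sequentially. P (f s)"
  obtains r where "0 < r" "\<forall>f. (\<forall>i<n. \<bar>f i - a i\<bar> < r) \<longrightarrow> P f"
proof (rule ccontr)
  assume no: "\<not> thesis"
  have "\<exists>f. (\<forall>i<n. \<bar>f i - a i\<bar> < inverse (real (Suc s))) \<and> \<not> P f" for s
  proof (rule ccontr)
    assume "\<not> ?thesis"
    then have "\<forall>f. (\<forall>i<n. \<bar>f i - a i\<bar> < inverse (real (Suc s))) \<longrightarrow> P f" by blast
    moreover have "0 < inverse (real (Suc s))" by simp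
    ultimately show False using no that by blast
  qed
  then have "\<exists>f. \<forall>s. (\<forall>i<n. \<bar>f s i - a i\<bar> < inverse (real (Suc s))) \<and> \<not> P (f s)"
    by (intro choice allI)
  then obtain f where f: "\<forall>s. (\<forall>i<n. \<bar>f s i - a i\<bar> < inverse (real (Suc s))) \<and> \<not> P (f s)" by blast
  have "(\<lambda>s. f s i) \<longlonglongrightarrow> a i" if "i < n" for i
  proof -
    have "(\<lambda>s. f s i - a i) \<longlonglongrightarrow> 0"
    proof (rule Lim_null_comparison)
      show "\<forall>\<^sub>F s in sequentially. norm (f s i - a i) \<le> inverse (real (Suc s))"
        using f that by (intro always_eventually allI) (auto intro: less_imp_le)
    qed (rule LIMSEQ_inverse_real_of_nat)
    then show ?thesis by (simp add: LIM_zero_iff)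
  qed
  from ev[of f, OF this] show False using f by (auto simp: eventually_sequentially)
qed

lemma emp_best_eq_0:
  assumes "valid_instance M n 0 m"
  shows "emp_best n m = 0"
proof -
  have "m j \<le> m 0" if "j < n" for j
    using assms that by (cases "j = 0") (auto simp: valid_instance_def intro: less_imp_le)
  then show ?thesis
    unfolding emp_best_def using assms by (intro Least_eq_0) (auto simp: valid_instance_def)
qed

lemma stage2_iters_le: "stage2_iters d M n \<delta> \<epsilon> L1 L2 \<alpha> X \<le> nat \<lceil>ln (1 / \<delta>)\<rceil>"
proof -
  define qm where "qm = nat \<lceil>ln (1 / \<delta>)\<rceil>"
  define P where "P q \<longleftrightarrow> 1 \<le> q \<and> q \<le> qm \<and> stage2_exit d M n \<delta> \<epsilon> L1 L2 \<alpha> X q" for q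
  have "(LEAST q. P q) \<le> qm" if "\<exists>q. P q"
    using LeastI_ex[OF that] by (simp add: P_def)
  then show ?thesis
    unfolding stage2_iters_def Let_def qm_def[symmetric] P_def[symmetric] by auto
qed

section \<open>Stability near the true instance\<close>

locale best_arm = bandit +
  assumes best: "0 < j \<Longrightarrow> j < n \<Longrightarrow> \<mu> j < \<mu> 0"
begin

abbreviation "d \<equiv> ef_kl \<rho> \<Theta>"
abbreviation "w \<equiv> wstar d M n 0 \<mu>"

text \<open>The ideal pull count of arm \<open>i\<close> per unit of log (1 / \<delta>), namely
  \<alpha> times optimal weight times characteristic time.\<close>

definition target :: "real \<Rightarrow> nat \<Rightarrow> real" where
  "target \<alpha> i = \<alpha> * w i / Tstar_inv d M n 0 \<mu>"

lemma valid_mu: "valid_instance M n 0 \<mu>"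
  using two_arms means best by (auto simp: valid_instance_def)

lemma target_pos: "0 < \<alpha> \<Longrightarrow> i < n \<Longrightarrow> 0 < target \<alpha> i"
  using Tstar_inv_pos[OF valid_mu two_arms]
    optimal_weights_pos[OF valid_mu two_arms wstar_optimal[OF valid_mu two_arms]]
  by (simp add: target_def)

lemma allocation_stable:
  assumes \<kappa>: "0 < \<kappa>"
  obtains r where "0 < r" "\<forall>lam. (\<forall>i<n. \<bar>lam i - \<mu> i\<bar> < r) \<longrightarrow>
    valid_instance M n 0 lam \<and> (\<forall>i<n. \<bar>wstar d M n 0 lam i - w i\<bar> < \<kappa> \<and>
      \<bar>\<alpha> * wstar d M n 0 lam i / Tstar_inv d M n 0 lam - target \<alpha> i\<bar> < \<kappa>)"
proof (rule coordinatewise_nbhd)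
  fix l :: "nat \<Rightarrow> nat \<Rightarrow> real" assume ll: "\<And>i. i < n \<Longrightarrow> (\<lambda>s. l s i) \<longlonglongrightarrow> \<mu> i"
  have "\<forall>\<^sub>F s in sequentially. \<forall>i\<in>{..<n}. l s i \<in> M"
    using topological_tendstoD[OF ll M_open means] by (intro eventually_ball_finite ballI) auto
  moreover have "\<forall>\<^sub>F s in sequentially. \<forall>j\<in>{0<..<n}. 0 < l s 0 - l s j"
  proof (intro eventually_ball_finite ballI)
    fix j assume j: "j \<in> {0<..<n}"
    then have "(\<lambda>s. l s 0 - l s j) \<longlonglongrightarrow> \<mu> 0 - \<mu> j" by (intro tendsto_diff ll) auto
    then show "\<forall>\<^sub>F s in sequentially. 0 < l s 0 - l s j"
      using best j by (intro order_tendstoD(1)) auto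
  qed simp
  ultimately have valid: "\<forall>\<^sub>F s in sequentially. valid_instance M n 0 (l s)"
    by eventually_elim (use two_arms in \<open>auto simp: valid_instance_def\<close>)
  \<comment> \<open>The continuity lemma wants every member of the sequence to be valid, so the
    finitely many invalid ones are replaced by \<mu>.\<close>
  define l' where "l' s = (if valid_instance M n 0 (l s) then l s else \<mu>)" for s
  have same: "\<forall>\<^sub>F s in sequentially. l' s = l s" using valid by eventually_elim (simp add: l'_def)
  have l'v: "valid_instance M n 0 (l' s)" for s using valid_mu by (simp add: l'_def)
  have l'l: "(\<lambda>s. l' s i) \<longlonglongrightarrow> \<mu> i" if "i < n" for i
  proof (rule Lim_transform_eventually[OF ll[OF that]])
    show "\<forall>\<^sub>F s in sequentially. l s i = l' s i" using same by eventually_elim simp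
  qed
  note lim = wstar_and_Tstar_inv_continuous[OF valid_mu two_arms l'v l'l]
  have "\<forall>\<^sub>F s in sequentially. \<forall>i\<in>{..<n}. \<bar>wstar d M n 0 (l' s) i - w i\<bar> < \<kappa>"
    using lim(1) \<kappa> by (intro eventually_ball_finite ballI) (auto simp flip: dist_real_def intro: tendstoD)
  moreover have "\<forall>\<^sub>F s in sequentially. \<forall>i\<in>{..<n}.
      \<bar>\<alpha> * wstar d M n 0 (l' s) i / Tstar_inv d M n 0 (l' s) - target \<alpha> i\<bar> < \<kappa>"
  proof (intro eventually_ball_finite ballI)
    fix i
    have "(\<lambda>s. \<alpha> * wstar d M n 0 (l' s) i / Tstar_inv d M n 0 (l' s)) \<longlonglongrightarrow> target \<alpha> i"
      unfolding target_def using Tstar_inv_pos[OF valid_mu two_arms]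
      by (intro tendsto_divide tendsto_mult tendsto_const lim) auto
    then show "\<forall>\<^sub>F s in sequentially.
        \<bar>\<alpha> * wstar d M n 0 (l' s) i / Tstar_inv d M n 0 (l' s) - target \<alpha> i\<bar> < \<kappa>"
      using \<kappa> by (auto simp flip: dist_real_def intro: tendstoD)
  qed simp
  ultimately show "\<forall>\<^sub>F s in sequentially. valid_instance M n 0 (l s) \<and>
    (\<forall>i<n. \<bar>wstar d M n 0 (l s) i - w i\<bar> < \<kappa> \<and>
      \<bar>\<alpha> * wstar d M n 0 (l s) i / Tstar_inv d M n 0 (l s) - target \<alpha> i\<bar> < \<kappa>)"
    using valid same by eventually_elim auto
qed (rule that)

text \<open>By homogeneity and optimality the cost of the target allocation is exactly \<open>\<alpha>\<close>.\<close>

lemma cost_stable: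
  assumes \<alpha>: "1 < \<alpha>"
  obtains \<kappa> where "0 < \<kappa>" "\<forall>y m. (\<forall>i<n. \<bar>y i - target \<alpha> i\<bar> < \<kappa> \<and> \<bar>m i - \<mu> i\<bar> < \<kappa>) \<longrightarrow>
    (\<forall>j<n. j \<noteq> 0 \<longrightarrow> (1 + \<alpha>) / 2 < pair_cost d (y 0) (y j) (m 0) (m j))"
proof -
  define V where "V = Tstar_inv d M n 0 \<mu>"
  have V: "0 < V" using Tstar_inv_pos[OF valid_mu two_arms] by (simp add: V_def)
  \<comment> \<open>Allocation and means are packed into one vector of length \<open>2 * n\<close>,
    so that a single neighbourhood controls both.\<close>
  define a where "a i = (if i < n then target \<alpha> i else \<mu> (i - n))" for i
  define P where "P f \<longleftrightarrow> (\<forall>j\<in>{0<..<n}. (1 + \<alpha>) / 2 < pair_cost d (f 0) (f j) (f n) (f (n + j)))"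
    for f :: "nat \<Rightarrow> real"
  have n0: "0 < n" using two_arms by simp
  obtain \<kappa> where \<kappa>: "0 < \<kappa>" "\<forall>f. (\<forall>i<2 * n. \<bar>f i - a i\<bar> < \<kappa>) \<longrightarrow> P f"
  proof (rule coordinatewise_nbhd)
    fix f :: "nat \<Rightarrow> nat \<Rightarrow> real" assume fl: "\<And>i. i < 2 * n \<Longrightarrow> (\<lambda>s. f s i) \<longlonglongrightarrow> a i"
    show "\<forall>\<^sub>F s in sequentially. P (f s)"
      unfolding P_def
    proof (intro eventually_ball_finite ballI)
      fix j assume j: "j \<in> {0<..<n}"
      have "(\<lambda>s. pair_cost d (f s 0) (f s j) (f s n) (f s (n + j)))
          \<longlonglongrightarrow> pair_cost d (a 0) (a j) (a n) (a (n + j))"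
      proof (rule tendsto_pair_cost)
        show "(\<lambda>s. f s 0) \<longlonglongrightarrow> a 0" "(\<lambda>s. f s j) \<longlonglongrightarrow> a j" "(\<lambda>s. f s n) \<longlonglongrightarrow> a n"
          "(\<lambda>s. f s (n + j)) \<longlonglongrightarrow> a (n + j)"
          using j n0 by (auto intro!: fl)
        show "a n \<in> M" "a (n + j) \<in> M" using j n0 means by (auto simp: a_def)
        have "0 < a 0" "0 < a j" using j n0 target_pos \<alpha> by (auto simp: a_def)
        then show "0 \<le> a 0" "0 \<le> a j" "0 < a 0 + a j" by auto
      qed
      also have "pair_cost d (a 0) (a j) (a n) (a (n + j))
          = pair_cost d ((\<alpha> / V) * w 0) ((\<alpha> / V) * w j) (\<mu> 0) (\<mu> j)"
        using j n0 by (simp add: a_def target_def V_def)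
      also have "\<dots> = \<alpha> / V * pair_cost d (w 0) (w j) (\<mu> 0) (\<mu> j)"
        using V \<alpha> by (intro pair_cost_scale) auto
      also have "\<dots> = \<alpha>"
        using optimal_weights_equalize[OF valid_mu two_arms wstar_optimal[OF valid_mu two_arms], of j] j V
        by (simp add: V_def)
      finally show "\<forall>\<^sub>F s in sequentially. (1 + \<alpha>) / 2 < pair_cost d (f s 0) (f s j) (f s n) (f s (n + j))"
        using \<alpha> by (intro order_tendstoD(1)) auto
    qed simp
  qed (rule that)
  show ?thesis
  proof (rule that[OF \<kappa>(1)], intro allI impI)
    fix y m j assume ym: "\<forall>i<n. \<bar>y i - target \<alpha> i\<bar> < \<kappa> \<and> \<bar>m i - \<mu> i\<bar> < \<kappa>" and j: "j < n" "j \<noteq> 0"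
    define f where "f i = (if i < n then y i else m (i - n))" for i
    have "P f" using \<kappa>(2) ym by (auto simp: f_def a_def)
    then show "(1 + \<alpha>) / 2 < pair_cost d (y 0) (y j) (m 0) (m j)"
      using j n0 by (auto simp: P_def f_def)
  qed
qed

text \<open>An invariant of the iterations, with the exit test ignored. The lower bound and the
  weight bound need one completed iteration, since the initial state knows only \<open>L1\<close>
  and uniform weights. The bound on \<open>L1\<close> keeps Stage I below the targets; the one on
  \<open>L2\<close> keeps the cap inactive.\<close>

lemma accurate_run:
  fixes \<delta> \<epsilon> L1 L2 \<alpha> \<kappa> r \<eta> L :: real and X :: "nat \<times> nat \<Rightarrow> real"
  defines "st \<equiv> \<lambda>q. stage2 d M n \<delta> \<epsilon> L1 L2 \<alpha> X q"
  assumes L: "L = ln (1 / \<delta>)" "0 < L" and \<alpha>: "0 < \<alpha>" and \<kappa>: "0 < \<kappa>"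
    and r: "\<forall>lam. (\<forall>i<n. \<bar>lam i - \<mu> i\<bar> < r) \<longrightarrow>
      valid_instance M n 0 lam \<and> (\<forall>i<n. \<bar>wstar d M n 0 lam i - w i\<bar> < \<kappa> \<and>
        \<bar>\<alpha> * wstar d M n 0 lam i / Tstar_inv d M n 0 lam - target \<alpha> i\<bar> < \<kappa>)"
    and X: "\<forall>i<n. \<forall>s\<ge>nat \<lceil>L1\<rceil>. \<bar>(\<Sum>j<s. X (i, j)) / real s - \<mu> i\<bar> < \<eta>"
    and \<eta>: "2 * \<eta> \<le> r" and \<epsilon>: "0 \<le> \<epsilon>" "\<epsilon> \<le> \<eta>" and L1: "0 \<le> L1" "L1 \<le> L * \<kappa>"
    and L2: "\<forall>i<n. L * (target \<alpha> i + \<kappa>) \<le> L2"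
  shows "\<forall>i<n. fst (st q) i = nat \<lceil>fst (snd (st q)) i\<rceil> \<and> L1 \<le> fst (snd (st q)) i
    \<and> fst (snd (st q)) i \<le> L * (target \<alpha> i + \<kappa>)
    \<and> (1 \<le> q \<longrightarrow> L * (target \<alpha> i - \<kappa>) \<le> fst (snd (st q)) i \<and> \<bar>snd (snd (st q)) i - w i\<bar> < \<kappa>)"
proof (induction q)
  case 0
  have "L * \<kappa> \<le> L * (target \<alpha> i + \<kappa>)" if "i < n" for i
    using target_pos[OF \<alpha> that] L by (intro mult_left_mono) auto
  then show ?case using L1 by (auto simp: st_def intro: order_trans)
next
  case (Suc q)
  define N Tm where "N = fst (st q)" and "Tm = fst (snd (st q))"
  define m where "m = emp_mean X N"
  have NT: "N i = nat \<lceil>Tm i\<rceil>" "L1 \<le> Tm i" "Tm i \<le> L * (target \<alpha> i + \<kappa>)" if "i < n" for i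
    using Suc that by (auto simp: N_def Tm_def)
  have m: "\<bar>m i - \<mu> i\<bar> < \<eta>" if i: "i < n" for i
  proof -
    have "nat \<lceil>L1\<rceil> \<le> N i" unfolding NT(1)[OF i] by (intro nat_mono ceiling_mono NT(2)[OF i])
    then show ?thesis using X i by (simp add: m_def emp_mean_def)
  qed
  have "\<bar>m i - \<mu> i\<bar> < r" if "i < n" for i using m[OF that] \<eta> by linarith
  then have k: "emp_best n m = 0" using r emp_best_eq_0 by blast
  define b where "b = (\<lambda>i. if i = 0 then m i - \<epsilon> else m i + \<epsilon>)"
  \<comment> \<open>The assumption \<open>2 * \<eta> \<le> r\<close> pays once for the sampling
    error and once for the shift by \<epsilon>.\<close>
  have "\<bar>b i - \<mu> i\<bar> < r" if "i < n" for i
    using m[OF that] \<eta> \<epsilon> unfolding b_def by (auto simp: abs_less_iff)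
  then have b: "valid_instance M n 0 b" "\<And>i. i < n \<Longrightarrow> \<bar>wstar d M n 0 b i - w i\<bar> < \<kappa>"
    "\<And>i. i < n \<Longrightarrow> \<bar>\<alpha> * wstar d M n 0 b i / Tstar_inv d M n 0 b - target \<alpha> i\<bar> < \<kappa>"
    using r by blast+
  define T where "T i = real_of_ereal (min (ereal \<alpha> * ereal (wstar d M n 0 b i) * Tstar d M n 0 b
      * ereal (ln (1 / \<delta>))) (ereal L2))" for i
  have eq: "st (Suc q) = ((\<lambda>i. if i < n then N i + nat (\<lceil>T i\<rceil> - \<lceil>Tm i\<rceil>) else 0),
      (\<lambda>i. max (Tm i) (T i)), wstar d M n 0 b)"
    unfolding st_def stage2.simps Let_def case_prod_unfold k[unfolded m_def N_def st_def]
      T_def b_def m_def N_def Tm_def by (rule refl)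
  show ?case
  proof (intro allI impI)
    fix i assume i: "i < n"
    define A where "A = \<alpha> * wstar d M n 0 b i / Tstar_inv d M n 0 b"
    have A: "\<bar>A - target \<alpha> i\<bar> < \<kappa>" using b(3)[OF i] by (simp add: A_def)
    have AL: "L * (target \<alpha> i - \<kappa>) \<le> L * A" "L * A \<le> L * (target \<alpha> i + \<kappa>)"
      using A L by (auto intro!: mult_left_mono)
    have "T i = min (L * A) L2"
      using b(1) by (simp add: T_def Tstar_def A_def L(1) ereal_min[symmetric] mult.commute del: ereal_min)
    then have T: "T i = L * A" using AL L2 i by (auto simp: min_def)
    \<comment> \<open>Batches only top up, so the count is always the rounded-up running
      maximum.\<close>
    have "N i + nat (\<lceil>T i\<rceil> - \<lceil>Tm i\<rceil>) = nat \<lceil>max (Tm i) (T i)\<rceil>"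
    proof (cases "Tm i \<le> T i")
      case True
      then have "\<lceil>Tm i\<rceil> \<le> \<lceil>T i\<rceil>" by (rule ceiling_mono)
      moreover have "0 \<le> \<lceil>Tm i\<rceil>" using NT[OF i] L1 by simp
      ultimately show ?thesis using True NT[OF i] by (simp add: max_def flip: nat_add_distrib)
    next
      case False
      then have "\<lceil>T i\<rceil> \<le> \<lceil>Tm i\<rceil>" by (intro ceiling_mono) simp
      then show ?thesis using False NT[OF i] by (simp add: max_def)
    qed
    then show "fst (st (Suc q)) i = nat \<lceil>fst (snd (st (Suc q))) i\<rceil>
        \<and> L1 \<le> fst (snd (st (Suc q))) i
        \<and> fst (snd (st (Suc q))) i \<le> L * (target \<alpha> i + \<kappa>)
        \<and> (1 \<le> Suc q \<longrightarrow> L * (target \<alpha> i - \<kappa>) \<le> fst (snd (st (Suc q))) i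
          \<and> \<bar>snd (snd (st (Suc q))) i - w i\<bar> < \<kappa>)"
      using i NT[OF i] T AL b(2)[OF i] by (simp add: eq le_max_iff_disj)
  qed
qed

end

context best_arm
begin

lemma three_batches:
  assumes \<alpha>: "1 < \<alpha>"
  obtains \<eta> where "0 < \<eta>"
    "\<forall>\<^sub>F L in at_top. \<forall>\<delta> X. 0 < \<delta> \<and> L = ln (1 / \<delta>) \<and>
      (\<forall>i<n. \<forall>s\<ge>nat \<lceil>sqrt L\<rceil>. \<bar>(\<Sum>j<s. X (i, j)) / real s - \<mu> i\<bar> < \<eta>)
      \<longrightarrow> B_delta \<rho> \<Theta> M n \<alpha> \<delta> X \<le> 3"
proof -
  obtain \<kappa>0 where \<kappa>0: "0 < \<kappa>0"
    "\<forall>y m. (\<forall>i<n. \<bar>y i - target \<alpha> i\<bar> < \<kappa>0 \<and> \<bar>m i - \<mu> i\<bar> < \<kappa>0) \<longrightarrow>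
      (\<forall>j<n. j \<noteq> 0 \<longrightarrow> (1 + \<alpha>) / 2 < pair_cost d (y 0) (y j) (m 0) (m j))"
    by (rule cost_stable[OF \<alpha>])
  \<comment> \<open>Half of \<open>\<kappa>0\<close> is for the allocation error, the other half for
    rounding. The second term lets two weights within \<kappa> of \<open>w\<close> pass the exit
    test.\<close>
  define \<kappa> where "\<kappa> = min (\<kappa>0 / 2) (1 / (2 * sqrt (real n)))"
  have \<kappa>: "0 < \<kappa>" "\<kappa> \<le> \<kappa>0 / 2" "2 * \<kappa> \<le> 1 / sqrt (real n)"
    using \<kappa>0(1) two_arms by (auto simp: \<kappa>_def min_def)
  obtain r where r: "0 < r" "\<forall>lam. (\<forall>i<n. \<bar>lam i - \<mu> i\<bar> < r) \<longrightarrow>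
    valid_instance M n 0 lam \<and> (\<forall>i<n. \<bar>wstar d M n 0 lam i - w i\<bar> < \<kappa> \<and>
      \<bar>\<alpha> * wstar d M n 0 lam i / Tstar_inv d M n 0 lam - target \<alpha> i\<bar> < \<kappa>)"
    by (rule allocation_stable[OF \<kappa>(1)])
  define \<eta> where "\<eta> = min (r / 2) \<kappa>0"
  have \<eta>: "0 < \<eta>" "2 * \<eta> \<le> r" "\<eta> \<le> \<kappa>0" using r \<kappa>0 by (auto simp: \<eta>_def)
  \<comment> \<open>\<open>C * L\<close> bounds the total of the ideal counts; \<open>D\<close> adds
    one pull per arm for rounding.\<close>
  define C where "C = (\<Sum>i<n. target \<alpha> i + \<kappa>)"
  define D where "D = C + real n"
  have tpos: "0 < target \<alpha> i" if "i < n" for i using target_pos \<alpha> that by simp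
  have tk: "0 \<le> target \<alpha> i + \<kappa>" if "i < n" for i using tpos[OF that] \<kappa>(1) by simp
  have C_ge: "target \<alpha> i + \<kappa> \<le> C" if "i < n" for i
    unfolding C_def by (rule member_le_sum[of i]) (use that tk in auto)
  have "0 \<le> C" unfolding C_def by (rule sum_nonneg) (use tk in auto)
  then have D: "0 < D" using two_arms by (simp add: D_def)
  have n0: "0 < real n" using two_arms by simp
  have \<gamma>: "0 < (\<alpha> - 1) / 2" using \<alpha> by simp
  have ev1: "\<forall>\<^sub>F L :: real in at_top. 1 < L" by (rule eventually_gt_at_top)
  have ev2: "\<forall>\<^sub>F L :: real in at_top. 0 < ln L \<and> 1 / ln L < \<eta>"
  proof (intro eventually_conj)
    show "\<forall>\<^sub>F L :: real in at_top. 0 < ln L" by real_asymp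
    have "((\<lambda>L :: real. 1 / ln L) \<longlongrightarrow> 0) at_top" by real_asymp
    then show "\<forall>\<^sub>F L :: real in at_top. 1 / ln L < \<eta>" using \<eta>(1) by (rule order_tendstoD)
  qed
  have ev3: "\<forall>\<^sub>F L :: real in at_top. C * real n \<le> ln L"
    using ln_at_top by (simp add: filterlim_at_top)
  have ev4: "\<forall>\<^sub>F L :: real in at_top. 1 / sqrt L < \<kappa>"
  proof -
    have "((\<lambda>L :: real. 1 / sqrt L) \<longlongrightarrow> 0) at_top" by real_asymp
    then show ?thesis using \<kappa>(1) by (rule order_tendstoD)
  qed
  have ev5: "\<forall>\<^sub>F L :: real in at_top. 1 / L < \<kappa>0 / 2"
  proof -
    have "((\<lambda>L :: real. 1 / L) \<longlongrightarrow> 0) at_top" by real_asymp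
    then show ?thesis using \<kappa>0(1) by (intro order_tendstoD(2)) auto
  qed
  \<comment> \<open>The threshold is at most \<open>L\<close> plus this numerator, because the total
    number of pulls enters only through a logarithm. The room available is the gap between
    \<open>L\<close> and the guaranteed statistic \<open>(1 + \<alpha>) / 2 * L\<close>.\<close>
  have ev6: "\<forall>\<^sub>F L :: real in at_top.
      (ln (L + ln 2) + \<alpha> * ln (D * L) + ln 2) / L < (\<alpha> - 1) / 2"
  proof -
    have "((\<lambda>L :: real. (ln (L + ln 2) + \<alpha> * ln (D * L) + ln 2) / L) \<longlongrightarrow> 0) at_top"
      using D by real_asymp
    then show ?thesis using \<gamma> by (rule order_tendstoD)
  qed
  have "\<forall>\<^sub>F L in at_top. \<forall>\<delta> X. 0 < \<delta> \<and> L = ln (1 / \<delta>) \<and>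
      (\<forall>i<n. \<forall>s\<ge>nat \<lceil>sqrt L\<rceil>. \<bar>(\<Sum>j<s. X (i, j)) / real s - \<mu> i\<bar> < \<eta>)
      \<longrightarrow> B_delta \<rho> \<Theta> M n \<alpha> \<delta> X \<le> 3"
    using ev1 ev2 ev3 ev4 ev5 ev6
  proof eventually_elim
    case (elim L)
    show ?case
    proof (intro allI impI, elim conjE)
      fix \<delta> and X :: "nat \<times> nat \<Rightarrow> real"
      assume \<delta>: "0 < \<delta>" and L: "L = ln (1 / \<delta>)"
        and X: "\<forall>i<n. \<forall>s\<ge>nat \<lceil>sqrt L\<rceil>. \<bar>(\<Sum>j<s. X (i, j)) / real s - \<mu> i\<bar> < \<eta>"
      define \<epsilon> L1 L2 where "\<epsilon> = 1 / ln L" and "L1 = sqrt L" and "L2 = L * ln L / real n"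
      define \<beta> where "\<beta> = (\<lambda>t \<delta>' :: real. ln (ln (1 / \<delta>') * t powr \<alpha> / \<delta>'))"
      define st where "st q = stage2 d M n \<delta> \<epsilon> L1 L2 \<alpha> X q" for q
      have L0: "0 < L" "1 < L" using elim by auto
      have L1: "0 < L1" "L1 \<le> L * \<kappa>"
      proof -
        show "0 < L1" using L0 by (simp add: L1_def)
        have "sqrt L * (1 / sqrt L) \<le> sqrt L * \<kappa>" using elim L0 by (intro mult_left_mono) auto
        then have "1 \<le> sqrt L * \<kappa>" using L0 by simp
        then have "sqrt L * 1 \<le> sqrt L * (sqrt L * \<kappa>)" using L0 by (intro mult_left_mono) auto
        then show "L1 \<le> L * \<kappa>" using L0 by (simp add: L1_def flip: mult.assoc)
      qed
      have L2: "\<forall>i<n. L * (target \<alpha> i + \<kappa>) \<le> L2"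
      proof (intro allI impI)
        fix i assume "i < n"
        then have "L * (target \<alpha> i + \<kappa>) \<le> L * C" using C_ge L0 by (intro mult_left_mono) auto
        also have "\<dots> \<le> L * (ln L / real n)"
          using elim n0 L0 by (intro mult_left_mono) (auto simp: field_simps)
        finally show "L * (target \<alpha> i + \<kappa>) \<le> L2" by (simp add: L2_def)
      qed
      have run: "\<forall>i<n. fst (st q) i = nat \<lceil>fst (snd (st q)) i\<rceil> \<and> L1 \<le> fst (snd (st q)) i
          \<and> fst (snd (st q)) i \<le> L * (target \<alpha> i + \<kappa>)
          \<and> (1 \<le> q \<longrightarrow> L * (target \<alpha> i - \<kappa>) \<le> fst (snd (st q)) i
            \<and> \<bar>snd (snd (st q)) i - w i\<bar> < \<kappa>)" for q
        unfolding st_def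
      proof (rule accurate_run[OF L L0(1) _ \<kappa>(1) r(2) _ \<eta>(2)])
        show "0 < \<alpha>" using \<alpha> by simp
        show "\<forall>i<n. \<forall>s\<ge>nat \<lceil>L1\<rceil>. \<bar>(\<Sum>j<s. X (i, j)) / real s - \<mu> i\<bar> < \<eta>"
          using X by (simp add: L1_def)
        show "0 \<le> \<epsilon>" "\<epsilon> \<le> \<eta>" using elim by (auto simp: \<epsilon>_def)
        show "0 \<le> L1" "L1 \<le> L * \<kappa>" using L1 by auto
        show "\<forall>i<n. L * (target \<alpha> i + \<kappa>) \<le> L2" by (rule L2)
      qed
      define it where "it = stage2_iters d M n \<delta> \<epsilon> L1 L2 \<alpha> X"
      \<comment> \<open>The first exit test compares with the uniform weights and may fail; the
        second compares two vectors near \<open>w\<close>. It is reached because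
        \<open>L > 1\<close> permits two iterations.\<close>
      have it: "1 \<le> it" "it \<le> 2"
      proof -
        define P where "P q \<longleftrightarrow> 1 \<le> q \<and> q \<le> nat \<lceil>ln (1 / \<delta>)\<rceil> \<and> stage2_exit d M n \<delta> \<epsilon> L1 L2 \<alpha> X q" for q
        have "1 < \<lceil>L\<rceil>" using L0 by (simp add: less_ceiling_iff)
        then have "2 \<le> nat \<lceil>L\<rceil>" by linarith
        moreover have "stage2_exit d M n \<delta> \<epsilon> L1 L2 \<alpha> X 2"
          unfolding stage2_exit_def st_def[symmetric]
        proof (intro allI impI)
          fix i assume "i < n"
          then have "\<bar>snd (snd (st 2)) i - w i\<bar> < \<kappa>" "\<bar>snd (snd (st (2 - 1))) i - w i\<bar> < \<kappa>"
            using run[of 2] run[of 1] by auto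
          then show "\<bar>snd (snd (st 2)) i - snd (snd (st (2 - 1))) i\<bar> \<le> 1 / sqrt (real n)"
            using \<kappa>(3) by linarith
        qed
        ultimately have "P 2" by (simp add: P_def flip: L)
        then have "it = (LEAST q. P q)"
          unfolding it_def stage2_iters_def Let_def P_def[symmetric] by auto
        then show "1 \<le> it" "it \<le> 2"
          using LeastI[of P, OF \<open>P 2\<close>] Least_le[of P, OF \<open>P 2\<close>] by (auto simp: P_def)
      qed
      define N where "N = fst (st it)"
      define Tm where "Tm = fst (snd (st it))"
      define m where "m = emp_mean X N"
      have N: "N i = nat \<lceil>Tm i\<rceil>" "L1 \<le> Tm i" "Tm i \<le> L * (target \<alpha> i + \<kappa>)" "L * (target \<alpha> i - \<kappa>) \<le> Tm i"
        if "i < n" for i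
        using run[of it] it that by (auto simp: N_def Tm_def)
      have N_bounds: "Tm i \<le> real (N i)" "real (N i) < Tm i + 1" if "i < n" for i
        using N[OF that] L1 by linarith+
      have m: "\<bar>m i - \<mu> i\<bar> < \<eta>" if i: "i < n" for i
      proof -
        have "nat \<lceil>sqrt L\<rceil> \<le> N i"
          unfolding N(1)[OF i] using N(2)[OF i] by (intro nat_mono ceiling_mono) (simp add: L1_def)
        then show ?thesis using X i by (simp add: m_def emp_mean_def)
      qed
      have "\<bar>m i - \<mu> i\<bar> < r" if "i < n" for i using m[OF that] \<eta>(1,2) by linarith
      then have k: "emp_best n m = 0" using r(2) emp_best_eq_0 by blast
      define y where "y i = real (N i) / L" for i
      have y: "\<bar>y i - target \<alpha> i\<bar> < \<kappa>0" if i: "i < n" for i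
      proof -
        have "L * (target \<alpha> i - \<kappa>) / L \<le> y i"
          unfolding y_def using N(4)[OF i] N_bounds[OF i] L0 by (intro divide_right_mono) auto
        then have lo: "target \<alpha> i - \<kappa> \<le> y i" using L0 by simp
        have "y i < (L * (target \<alpha> i + \<kappa>) + 1) / L"
          unfolding y_def using N(3)[OF i] N_bounds[OF i] L0 by (intro divide_strict_right_mono) auto
        also have "\<dots> = target \<alpha> i + \<kappa> + 1 / L" using L0 by (simp add: add_divide_distrib)
        finally have "y i < target \<alpha> i + \<kappa>0" using elim \<kappa>(2) by linarith
        then show ?thesis using lo \<kappa>(1,2) \<kappa>0(1) by linarith
      qed
      have cost: "(1 + \<alpha>) / 2 * L \<le> Zstat d (N 0) (N j) (m 0) (m j)" if j: "j < n" "j \<noteq> 0" for j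
      proof -
        have "(1 + \<alpha>) / 2 < pair_cost d (y 0) (y j) (m 0) (m j)"
          using \<kappa>0(2) y m \<eta>(3) j by (meson less_le_trans)
        then have "L * ((1 + \<alpha>) / 2) \<le> L * pair_cost d (y 0) (y j) (m 0) (m j)"
          using L0 by (intro mult_left_mono) auto
        also have "\<dots> = pair_cost d (L * y 0) (L * y j) (m 0) (m j)"
          using L0 by (simp add: pair_cost_scale)
        also have "\<dots> = Zstat d (N 0) (N j) (m 0) (m j)"
          using L0 by (simp add: y_def Zstat_eq_pair_cost)
        finally show ?thesis by (simp add: mult.commute)
      qed
      define \<tau> where "\<tau> = real (\<Sum>i<n. N i)"
      have \<tau>: "0 < \<tau>" "\<tau> \<le> D * L"
      proof -
        have "0 < real (N 0)" using N_bounds[of 0] N(2)[of 0] L1 two_arms by linarith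
        also have "\<dots> \<le> \<tau>" unfolding \<tau>_def of_nat_sum using two_arms by (intro member_le_sum) auto
        finally show "0 < \<tau>" .
        have "\<tau> \<le> (\<Sum>i<n. L * (target \<alpha> i + \<kappa>) + 1)"
          unfolding \<tau>_def of_nat_sum using N_bounds N(3) by (intro sum_mono) force
        also have "\<dots> = L * C + real n" by (simp add: C_def sum.distrib flip: sum_distrib_left)
        also have "\<dots> \<le> L * C + L * real n" using L0 n0 by simp
        finally show "\<tau> \<le> D * L" by (simp add: D_def algebra_simps)
      qed
      have threshold: "\<beta> \<tau> (\<delta> / 2) \<le> (1 + \<alpha>) / 2 * L"
      proof -
        have l2: "ln (1 / (\<delta> / 2)) = L + ln 2"
          using \<delta> by (simp add: L ln_div)
        have p: "0 < L + ln 2" using L0 by (simp add: add_pos_pos)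
        have "\<beta> \<tau> (\<delta> / 2) = ln ((L + ln 2) * \<tau> powr \<alpha> * (1 / (\<delta> / 2)))"
          unfolding \<beta>_def l2 by simp
        also have "\<dots> = ln ((L + ln 2) * \<tau> powr \<alpha>) + ln (1 / (\<delta> / 2))"
          using p \<tau>(1) \<delta> by (intro ln_mult_pos) auto
        also have "\<dots> = ln (L + ln 2) + ln (\<tau> powr \<alpha>) + (L + ln 2)"
          unfolding l2 using p \<tau>(1) by (subst ln_mult_pos) auto
        also have "ln (\<tau> powr \<alpha>) = \<alpha> * ln \<tau>" using \<tau>(1) by (simp add: ln_powr)
        also have "\<alpha> * ln \<tau> \<le> \<alpha> * ln (D * L)" using \<alpha> \<tau> D L0 by (intro mult_left_mono) auto
        finally have "\<beta> \<tau> (\<delta> / 2) \<le> (ln (L + ln 2) + \<alpha> * ln (D * L) + ln 2) + L" by simp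
        also have "ln (L + ln 2) + \<alpha> * ln (D * L) + ln 2 \<le> (\<alpha> - 1) / 2 * L"
          using elim L0 by (simp add: pos_divide_less_eq)
        finally show ?thesis by (simp add: field_simps)
      qed
      have "stage3_stops d M n \<delta> \<epsilon> L1 L2 \<alpha> \<beta> X"
        unfolding stage3_stops_def Let_def it_def[symmetric] st_def[symmetric] N_def[symmetric]
          m_def[symmetric] \<tau>_def[symmetric] k
        using order_trans[OF threshold cost] by blast
      moreover have "B_delta \<rho> \<Theta> M n \<alpha> \<delta> X
          = 1 + it + (if stage3_stops d M n \<delta> \<epsilon> L1 L2 \<alpha> \<beta> X then 0 else 1)"
        unfolding B_delta_def tri_bbai_batches_def it_def \<epsilon>_def L1_def L2_def \<beta>_def L by simp
      ultimately show "B_delta \<rho> \<Theta> M n \<alpha> \<delta> X \<le> 3" using it by simp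
    qed
  qed
  then show ?thesis using that \<eta>(1) by blast
qed

text \<open>Both conclusions follow from one event: off it at most three batches are used, on it at
  most \<open>log (1 / \<delta>) + 3\<close>, and its probability is at most \<open>(log (1 / \<delta>))\<^sup>-\<^sup>2\<close>.\<close>

lemma rare_bad_event:
  assumes \<alpha>: "1 < \<alpha>"
  obtains L0 where "1 < L0"
    "\<forall>\<delta>>0. L0 \<le> ln (1 / \<delta>) \<longrightarrow> (\<exists>A\<in>sets \<S>. measure \<S> A \<le> 1 / (ln (1 / \<delta>))\<^sup>2 \<and>
      (\<forall>X\<in>space \<S>. X \<notin> A \<longrightarrow> B_delta \<rho> \<Theta> M n \<alpha> \<delta> X \<le> 3))"
proof -
  obtain \<eta> where \<eta>: "0 < \<eta>"
    "\<forall>\<^sub>F L in at_top. \<forall>\<delta> X. 0 < \<delta> \<and> L = ln (1 / \<delta>) \<and>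
      (\<forall>i<n. \<forall>s\<ge>nat \<lceil>sqrt L\<rceil>. \<bar>(\<Sum>j<s. X (i, j)) / real s - \<mu> i\<bar> < \<eta>)
      \<longrightarrow> B_delta \<rho> \<Theta> M n \<alpha> \<delta> X \<le> 3"
    by (rule three_batches[OF \<alpha>])
  obtain K c where Kc: "0 < c" "c < 1" "0 \<le> K"
    "\<forall>s0\<ge>1. measure \<S> (deviation_event \<eta> s0) \<le> K * c ^ s0"
    by (rule deviation_bound[OF \<eta>(1)])
  define g where "g = - ln c"
  have g: "0 < g" "c = exp (- g)" using Kc by (auto simp: g_def)
  \<comment> \<open>The exponent is only of order \<open>sqrt L\<close>, the number of Stage I pulls
    per arm, but it still beats the factor \<open>L\<^sup>2\<close>.\<close>
  have "((\<lambda>L :: real. K * exp (- g * sqrt L) * L\<^sup>2) \<longlongrightarrow> 0) at_top"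
  proof -
    have "((\<lambda>L :: real. exp (- g * sqrt L) * L\<^sup>2) \<longlongrightarrow> 0) at_top" using g(1) by real_asymp
    from tendsto_mult[OF tendsto_const[of K] this] show ?thesis by (simp add: mult.assoc)
  qed
  then have "\<forall>\<^sub>F L :: real in at_top. K * exp (- g * sqrt L) * L\<^sup>2 < 1"
    by (rule order_tendstoD) simp
  from eventually_conj[OF this \<eta>(2)] obtain L' where L': "\<And>L. L' \<le> L \<Longrightarrow>
    K * exp (- g * sqrt L) * L\<^sup>2 < 1 \<and> (\<forall>\<delta> X. 0 < \<delta> \<and> L = ln (1 / \<delta>) \<and>
      (\<forall>i<n. \<forall>s\<ge>nat \<lceil>sqrt L\<rceil>. \<bar>(\<Sum>j<s. X (i, j)) / real s - \<mu> i\<bar> < \<eta>)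
      \<longrightarrow> B_delta \<rho> \<Theta> M n \<alpha> \<delta> X \<le> 3)"
    unfolding eventually_at_top_linorder by blast
  show ?thesis
  proof (rule that[of "max L' 2"], simp, intro allI impI)
    fix \<delta> :: real assume \<delta>: "0 < \<delta>" "max L' 2 \<le> ln (1 / \<delta>)"
    define L where "L = ln (1 / \<delta>)"
    define s0 where "s0 = nat \<lceil>sqrt L\<rceil>"
    have L: "L' \<le> L" "2 \<le> L" using \<delta> by (auto simp: L_def)
    have s0: "1 \<le> s0" "sqrt L \<le> real s0"
    proof -
      have "0 < sqrt L" using L by simp
      then have "0 < \<lceil>sqrt L\<rceil>" by (simp only: zero_less_ceiling)
      then show "1 \<le> s0" unfolding s0_def by linarith
      show "sqrt L \<le> real s0" unfolding s0_def by linarith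
    qed
    have "measure \<S> (deviation_event \<eta> s0) \<le> K * c ^ s0" using Kc s0 by blast
    also have "c ^ s0 = exp (- g * real s0)" unfolding g(2) by (simp add: mult.commute flip: exp_of_nat_mult)
    also have "K * \<dots> \<le> K * exp (- g * sqrt L)" using Kc s0 g by (intro mult_left_mono) auto
    also have "\<dots> \<le> 1 / L\<^sup>2" using L'[OF L(1)] L by (simp add: pos_le_divide_eq)
    finally have small: "measure \<S> (deviation_event \<eta> s0) \<le> 1 / L\<^sup>2" .
    have "B_delta \<rho> \<Theta> M n \<alpha> \<delta> X \<le> 3" if X: "X \<in> space \<S>" "X \<notin> deviation_event \<eta> s0" for X
    proof -
      have "\<forall>i<n. \<forall>s\<ge>s0. \<bar>(\<Sum>j<s. X (i, j)) / real s - \<mu> i\<bar> < \<eta>"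
        using X unfolding deviation_event_def mem_Collect_eq by (meson not_le)
      then show ?thesis using L'[OF L(1)] \<delta>(1) by (simp add: s0_def L_def)
    qed
    then show "\<exists>A\<in>sets \<S>. measure \<S> A \<le> 1 / (ln (1 / \<delta>))\<^sup>2 \<and>
      (\<forall>X\<in>space \<S>. X \<notin> A \<longrightarrow> B_delta \<rho> \<Theta> M n \<alpha> \<delta> X \<le> 3)"
      using small deviation_event_measurable unfolding L_def by blast
  qed
qed

text \<open>The 3 accounts for Stage I, Stage IV and the rounding of the iteration limit.\<close>

lemma B_delta_le:
  assumes "0 < ln (1 / \<delta>)"
  shows "real (B_delta \<rho> \<Theta> M n \<alpha> \<delta> X) \<le> ln (1 / \<delta>) + 3"
proof -
  have "real (B_delta \<rho> \<Theta> M n \<alpha> \<delta> X) \<le> real (2 + nat \<lceil>ln (1 / \<delta>)\<rceil>)"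
    unfolding B_delta_def tri_bbai_batches_def of_nat_le_iff
    using stage2_iters_le[of d M n \<delta> "1 / ln (ln (1 / \<delta>))" "sqrt (ln (1 / \<delta>))"
        "ln (1 / \<delta>) * ln (ln (1 / \<delta>)) / real n" \<alpha> X] by simp
  also have "\<dots> \<le> ln (1 / \<delta>) + 3" using assms by simp linarith
  finally show ?thesis .
qed

text \<open>The worst case grows linearly in log (1 / \<delta>) while the bad event has
  inverse-square probability, so its contribution vanishes in the limit.\<close>

lemma expected_batches_le:
  assumes L: "0 < ln (1 / \<delta>)" and A: "A \<in> sets \<S>" "measure \<S> A \<le> 1 / (ln (1 / \<delta>))\<^sup>2"
    and good: "\<forall>X\<in>space \<S>. X \<notin> A \<longrightarrow> B_delta \<rho> \<Theta> M n \<alpha> \<delta> X \<le> 3"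
  shows "(\<integral>X. real (B_delta \<rho> \<Theta> M n \<alpha> \<delta> X) \<partial>\<S>) \<le> 3 + (ln (1 / \<delta>) + 3) / (ln (1 / \<delta>))\<^sup>2"
proof -
  define L where "L = ln (1 / \<delta>)"
  have [measurable]: "(\<lambda>X. real (B_delta \<rho> \<Theta> M n \<alpha> \<delta> X)) \<in> borel_measurable \<S>"
    using B_delta_measurable by (rule measurable_compose) simp
  have "(\<integral>X. real (B_delta \<rho> \<Theta> M n \<alpha> \<delta> X) \<partial>\<S>) \<le> (\<integral>X. 3 + (L + 3) * indicator A X \<partial>\<S>)"
  proof (rule integral_mono)
    show "integrable \<S> (\<lambda>X. real (B_delta \<rho> \<Theta> M n \<alpha> \<delta> X))"
      using B_delta_le[OF L] by (intro S.integrable_const_bound[of _ "ln (1 / \<delta>) + 3"]) auto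
    show "integrable \<S> (\<lambda>X. 3 + (L + 3) * indicator A X)"
      using A by (intro S.integrable_const_bound[of _ "3 + \<bar>L + 3\<bar>"]) (auto simp: indicator_def)
    fix X assume "X \<in> space \<S>"
    then show "real (B_delta \<rho> \<Theta> M n \<alpha> \<delta> X) \<le> 3 + (L + 3) * indicator A X"
      using good B_delta_le[OF L, of \<alpha> X] by (cases "X \<in> A") (auto simp: L_def)
  qed
  also have "\<dots> = 3 + (L + 3) * measure \<S> A"
  proof -
    have "integrable \<S> (indicat_real A)"
      using A by (simp add: integrable_indicator_iff S.emeasure_eq_measure)
    then show ?thesis using A S.prob_space by (simp add: integral_indicator)
  qed
  also have "\<dots> \<le> 3 + (L + 3) * (1 / L\<^sup>2)"
    using A L by (intro add_left_mono mult_left_mono) (auto simp: L_def)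
  finally show ?thesis by (simp add: L_def)
qed

end

text \<open>Measurability belongs to the conclusion because integrals of non-measurable functions
  are 0 by convention, which would leave the bound on the expectation without content.\<close>

theorem mainTheorem3:
  fixes \<rho> :: "real measure" and \<Theta> M :: "real set"
    and n :: nat and \<mu> :: "nat \<Rightarrow> real" and \<alpha> :: real
  assumes fam: "canonical_expfam \<rho> \<Theta> M"
    and n2: "n \<ge> 2"
    and muM: "\<forall>i<n. \<mu> i \<in> M"
    and best: "\<mu> 0 > \<mu> 1"
    and sorted: "\<forall>i. 1 \<le> i \<and> i + 1 < n \<longrightarrow> \<mu> (i + 1) \<le> \<mu> i"
    and alpha: "1 < \<alpha>" "\<alpha> \<le> exp 1 / 2"
  shows "(\<forall>\<delta>\<in>{0<..<1}. B_delta \<rho> \<Theta> M n \<alpha> \<delta>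
              \<in> sample_space \<rho> \<Theta> n \<mu> \<rightarrow>\<^sub>M count_space UNIV)
    \<and> Limsup (at_right 0)
        (\<lambda>\<delta>. ereal (\<integral>X. real (B_delta \<rho> \<Theta> M n \<alpha> \<delta> X) \<partial>sample_space \<rho> \<Theta> n \<mu>)) \<le> 3
    \<and> (\<exists>\<delta>0\<in>{0<..<1}. \<forall>\<delta>\<in>{0<..<\<delta>0}.
          measure (sample_space \<rho> \<Theta> n \<mu>)
            {X \<in> space (sample_space \<rho> \<Theta> n \<mu>). B_delta \<rho> \<Theta> M n \<alpha> \<delta> X \<le> 3}
          \<ge> 1 - 1 / (ln (1 / \<delta>))\<^sup>2)"
proof -
  have le1: "j < n \<Longrightarrow> \<mu> j \<le> \<mu> 1" if "1 \<le> j" for j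
    using that
  proof (induction j rule: dec_induct)
    case (step j)
    then show ?case using sorted by (metis Suc_eq_plus1 Suc_lessD order_trans)
  qed simp
  interpret best_arm \<rho> \<Theta> M n \<mu>
  proof
    show "\<mu> j < \<mu> 0" if "0 < j" "j < n" for j using le1[of j] that best by simp
  qed (use fam n2 muM in auto)
  obtain L0 where L0: "1 < L0"
    "\<forall>\<delta>>0. L0 \<le> ln (1 / \<delta>) \<longrightarrow> (\<exists>A\<in>sets \<S>. measure \<S> A \<le> 1 / (ln (1 / \<delta>))\<^sup>2 \<and>
      (\<forall>X\<in>space \<S>. X \<notin> A \<longrightarrow> B_delta \<rho> \<Theta> M n \<alpha> \<delta> X \<le> 3))"
    by (rule rare_bad_event[OF alpha(1)])
  define \<delta>0 where "\<delta>0 = exp (- L0)"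
  have \<delta>0: "\<delta>0 \<in> {0<..<1}" using L0(1) by (simp add: \<delta>0_def)
  have L: "L0 \<le> ln (1 / \<delta>)" if "\<delta> \<in> {0<..<\<delta>0}" for \<delta>
  proof -
    have "ln \<delta> < ln \<delta>0" using that \<delta>0 by simp
    then show ?thesis using that by (simp add: \<delta>0_def ln_div)
  qed
  have prob: "1 - 1 / (ln (1 / \<delta>))\<^sup>2 \<le> measure \<S> {X \<in> space \<S>. B_delta \<rho> \<Theta> M n \<alpha> \<delta> X \<le> 3}"
    if \<delta>: "\<delta> \<in> {0<..<\<delta>0}" for \<delta>
  proof -
    obtain A where A: "A \<in> sets \<S>" "measure \<S> A \<le> 1 / (ln (1 / \<delta>))\<^sup>2"
      "\<forall>X\<in>space \<S>. X \<notin> A \<longrightarrow> B_delta \<rho> \<Theta> M n \<alpha> \<delta> X \<le> 3"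
      using L0(2) L[OF \<delta>] \<delta> by (metis greaterThanLessThan_iff)
    have "{X \<in> space \<S>. B_delta \<rho> \<Theta> M n \<alpha> \<delta> X \<le> 3} = B_delta \<rho> \<Theta> M n \<alpha> \<delta> -` {..3} \<inter> space \<S>"
      by auto
    also have "\<dots> \<in> sets \<S>" using B_delta_measurable by (rule measurable_sets) simp
    finally have "measure \<S> (space \<S> - A) \<le> measure \<S> {X \<in> space \<S>. B_delta \<rho> \<Theta> M n \<alpha> \<delta> X \<le> 3}"
      using A(3) by (intro S.finite_measure_mono) auto
    then show ?thesis using A(1,2) S.prob_compl[of A] by simp
  qed
  have "Limsup (at_right 0) (\<lambda>\<delta>. ereal (\<integral>X. real (B_delta \<rho> \<Theta> M n \<alpha> \<delta> X) \<partial>\<S>))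
      \<le> Limsup (at_right 0) (\<lambda>\<delta>. ereal (3 + (ln (1 / \<delta>) + 3) / (ln (1 / \<delta>))\<^sup>2))"
  proof (rule Limsup_mono)
    have "\<forall>\<^sub>F \<delta> in at_right 0. \<delta> \<in> {0<..<\<delta>0}" using \<delta>0 by (intro eventually_at_right_real) auto
    then show "\<forall>\<^sub>F \<delta> in at_right 0. ereal (\<integral>X. real (B_delta \<rho> \<Theta> M n \<alpha> \<delta> X) \<partial>\<S>)
        \<le> ereal (3 + (ln (1 / \<delta>) + 3) / (ln (1 / \<delta>))\<^sup>2)"
    proof eventually_elim
      case (elim \<delta>)
      obtain A where "A \<in> sets \<S>" "measure \<S> A \<le> 1 / (ln (1 / \<delta>))\<^sup>2"
        "\<forall>X\<in>space \<S>. X \<notin> A \<longrightarrow> B_delta \<rho> \<Theta> M n \<alpha> \<delta> X \<le> 3"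
        using L0(2) L[OF elim] elim by (metis greaterThanLessThan_iff)
      moreover have "0 < ln (1 / \<delta>)" using L[OF elim] L0(1) by linarith
      ultimately show ?case using expected_batches_le by simp
    qed
  qed
  also have "\<dots> = 3"
  proof -
    have "((\<lambda>\<delta> :: real. 3 + (ln (1 / \<delta>) + 3) / (ln (1 / \<delta>))\<^sup>2) \<longlongrightarrow> 3) (at_right 0)"
      by real_asymp
    then have "((\<lambda>\<delta> :: real. ereal (3 + (ln (1 / \<delta>) + 3) / (ln (1 / \<delta>))\<^sup>2)) \<longlongrightarrow> ereal 3) (at_right 0)"
      by (rule tendsto_ereal)
    then show ?thesis using lim_imp_Limsup by (metis numeral_eq_ereal trivial_limit_at_right_real)
  qed
  finally have "Limsup (at_right 0) (\<lambda>\<delta>. ereal (\<integral>X. real (B_delta \<rho> \<Theta> M n \<alpha> \<delta> X) \<partial>\<S>)) \<le> 3" .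
  then show ?thesis using B_delta_measurable prob \<delta>0 by blast
qed

end
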